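(* Let $n\ge3$, $\rho,\lambda\in\mathbb{R}$, and let $(M^n,g,f,\lambda)$ be a gradient $\rho$-Einstein soliton. If $\rho=0$, assume in addition that $dR\wedge df=0$. At a regular point of $f$ define $$\mu=n\xi_1^2-2R\xi_1-\big((n-1)|Ric|^2-R^2\big),\qquad \xi_1=\frac12\big(1-2(n-1)\rho\big)\frac{\langle\nabla R,\nabla f\rangle}{|\nabla f|^2}.$$ Then at every regular point of $f$ the Bach tensor of $M$ satisfies $$B(\nabla f,X)=\frac{\mu}{(n-1)(n-2)^2}\,g(\nabla f,X)\qquad\text{for all } X\in\mathfrak{X}(M).$$
   Context: A gradient $\rho$-Einstein soliton $(M^n,g,f,\lambda)$, $n\ge3$, is a Riemannian manifold $(M^n,g)$ with a smooth function $f:M\to\mathbb{R}$ such that $Ric+\nabla^2 f=(\rho R+\lambda)g$, where $\rho,\lambda\in\mathbb{R}$ are constants and $R$ is the scalar curvature. A regular point of $f$ is a point where $\nabla f\ne0$. Under the stated hypotheses, $\xi_1$ is the eigenvalue of $Ric$ in the direction $\nabla f$: $Ric(\nabla f,\cdot)=\xi_1g(\nabla f,\cdot)$ at regular points. Conventions (index notation, Einstein summation): $R_{ijkl}$ is normalized so that $R_{ik}=g^{jl}R_{ijkl}$ is the Ricci tensor and $R=g^{ik}R_{ik}$ (round spheres have $Ric>0$). The Weyl and Cotton tensors are $$W_{ijkl}=R_{ijkl}-\tfrac{1}{n-2}(g_{ik}R_{jl}-g_{il}R_{jk}-g_{jk}R_{il}+g_{jl}R_{ik})+\tfrac{R}{(n-1)(n-2)}(g_{ik}g_{jl}-g_{il}g_{jk}),$$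 $$C_{ijk}=\nabla_iR_{jk}-\nabla_jR_{ik}-\tfrac{1}{2(n-1)}(g_{jk}\nabla_iR-g_{ik}\nabla_jR).$$ The Bach tensor is defined for all $n\ge3$ by $(n-2)B_{ij}=\nabla^kC_{kij}+R_{kl}W_{i\ j}^{\ k\ l}$ (for $n=3$, $W=0$ and $B_{ij}=\nabla^kC_{kij}$). *)

theory Defs
  imports "HOL-Analysis.Analysis"
begin

section \<open>Smooth functions on open subsets of Euclidean space\<close>

definition pd :: "'n::finite \<Rightarrow> (real^'n \<Rightarrow> real) \<Rightarrow> real^'n \<Rightarrow> real" where
  "pd i u = (\<lambda>x. frechet_derivative u (at x) (axis i 1))"

primrec iter_pd :: "'n::finite list \<Rightarrow> (real^'n \<Rightarrow> real) \<Rightarrow> real^'n \<Rightarrow> real" where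
  "iter_pd [] u = u"
| "iter_pd (i # is) u = pd i (iter_pd is u)"

text \<open>On an open set, \<open>C\<close>-infinity is the same as: all iterated partial derivatives (the function
  itself included) are differentiable.  The definition is only used for open sets.\<close>

definition smooth_fun_on :: "(real^'n::finite) set \<Rightarrow> (real^'n \<Rightarrow> real) \<Rightarrow> bool" where
  "smooth_fun_on S u \<longleftrightarrow> (\<forall>is. \<forall>x\<in>S. iter_pd is u differentiable (at x))"

section \<open>Smooth manifolds and tensor fields on them\<close>

type_synonym ('m, 'n) chart = "'m set \<times> ('m \<Rightarrow> real^'n)"

abbreviation chart_dom :: "('m, 'n::finite) chart \<Rightarrow> 'm set" where
  "chart_dom c \<equiv> fst c"

abbreviation chart_map :: "('m, 'n::finite) chart \<Rightarrow> 'm \<Rightarrow> real^'n" where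
  "chart_map c \<equiv> snd c"

definition chart_img :: "('m, 'n::finite) chart \<Rightarrow> (real^'n) set" where
  "chart_img c = chart_map c ` chart_dom c"

definition chart_inv :: "('m, 'n::finite) chart \<Rightarrow> real^'n \<Rightarrow> 'm" where
  "chart_inv c = inv_into (chart_dom c) (chart_map c)"

definition transition :: "('m, 'n::finite) chart \<Rightarrow> ('m, 'n) chart \<Rightarrow> real^'n \<Rightarrow> real^'n" where
  "transition c d = chart_map d \<circ> chart_inv c"

definition is_chart :: "'m topology \<Rightarrow> ('m, 'n::finite) chart \<Rightarrow> bool" where
  "is_chart M c \<longleftrightarrow>
     openin M (chart_dom c) \<and> open (chart_img c) \<and>
     homeomorphic_map (subtopology M (chart_dom c)) (top_of_set (chart_img c)) (chart_map c)"

definition smooth_manifold :: "'m topology \<Rightarrow> ('m, 'n::finite) chart set \<Rightarrow> bool" where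
  "smooth_manifold M A \<longleftrightarrow>
     Hausdorff_space M \<and> second_countable M \<and>
     (\<forall>c\<in>A. is_chart M c) \<and> topspace M = (\<Union>c\<in>A. chart_dom c) \<and>
     (\<forall>c\<in>A. \<forall>d\<in>A. \<forall>k.
        smooth_fun_on (chart_map c ` (chart_dom c \<inter> chart_dom d)) (\<lambda>x. transition c d x $ k))"

definition in_chart :: "('m, 'n::finite) chart \<Rightarrow> ('m \<Rightarrow> real) \<Rightarrow> real^'n \<Rightarrow> real" where
  "in_chart c f = f \<circ> chart_inv c"

definition smooth_function :: "('m, 'n::finite) chart set \<Rightarrow> ('m \<Rightarrow> real) \<Rightarrow> bool" where
  "smooth_function A f \<longleftrightarrow> (\<forall>c\<in>A. smooth_fun_on (chart_img c) (in_chart c f))"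

text \<open>Tensor fields are given classically, by their components in every chart of the atlas (as
  functions of the chart coordinates) subject to the transformation law.  Values outside the image
  of the chart are irrelevant.\<close>

definition vector_field ::
  "('m, 'n::finite) chart set \<Rightarrow> (('m, 'n) chart \<Rightarrow> real^'n \<Rightarrow> real^'n) \<Rightarrow> bool" where
  "vector_field A X \<longleftrightarrow>
     (\<forall>c\<in>A. \<forall>i. smooth_fun_on (chart_img c) (\<lambda>x. X c x $ i)) \<and>
     (\<forall>c\<in>A. \<forall>d\<in>A. \<forall>p \<in> chart_dom c \<inter> chart_dom d.
        X d (chart_map d p) =
          jacobian (transition c d) (at (chart_map c p)) *v X c (chart_map c p))"

definition riemannian_metric ::
  "('m, 'n::finite) chart set \<Rightarrow> (('m, 'n) chart \<Rightarrow> real^'n \<Rightarrow> real^'n^'n) \<Rightarrow> bool" where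
  "riemannian_metric A g \<longleftrightarrow>
     (\<forall>c\<in>A. \<forall>i j. smooth_fun_on (chart_img c) (\<lambda>x. g c x $ i $ j)) \<and>
     (\<forall>c\<in>A. \<forall>x\<in>chart_img c.
        transpose (g c x) = g c x \<and> (\<forall>v. v \<noteq> 0 \<longrightarrow> v \<bullet> (g c x *v v) > 0)) \<and>
     (\<forall>c\<in>A. \<forall>d\<in>A. \<forall>p \<in> chart_dom c \<inter> chart_dom d.
        g c (chart_map c p) =
          transpose (jacobian (transition c d) (at (chart_map c p))) ** g d (chart_map d p)
            ** jacobian (transition c d) (at (chart_map c p)))"

section \<open>Riemannian geometry in local coordinates\<close>

text \<open>Below, \<open>G\<close> is the component matrix of the metric in a chart, and a covariant tensor field is
  a function from its indices to functions of the coordinates.\<close>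

type_synonym 'n metric = "real^'n \<Rightarrow> real^'n^'n"

definition lower :: "('n::finite) metric \<Rightarrow> 'n \<Rightarrow> 'n \<Rightarrow> real^'n \<Rightarrow> real" where
  "lower G i j x = G x $ i $ j"

definition upper :: "('n::finite) metric \<Rightarrow> 'n \<Rightarrow> 'n \<Rightarrow> real^'n \<Rightarrow> real" where
  "upper G i j x = matrix_inv (G x) $ i $ j"

definition metric_form :: "('n::finite) metric \<Rightarrow> real^'n \<Rightarrow> real^'n \<Rightarrow> real^'n \<Rightarrow> real" where
  "metric_form G x v w = (\<Sum>i\<in>UNIV. \<Sum>j\<in>UNIV. lower G i j x * v $ i * w $ j)"

text \<open>\<open>christoffel G k i j\<close> has the upper index \<open>k\<close>.\<close>

definition christoffel :: "('n::finite) metric \<Rightarrow> 'n \<Rightarrow> 'n \<Rightarrow> 'n \<Rightarrow> real^'n \<Rightarrow> real" where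
  "christoffel G k i j x =
     (\<Sum>l\<in>UNIV. upper G k l x *
        (pd i (lower G j l) x + pd j (lower G i l) x - pd l (lower G i j) x)) / 2"

text \<open>Covariant derivatives; the first index is the direction of differentiation.\<close>

definition cov1 ::
  "('n::finite) metric \<Rightarrow> ('n \<Rightarrow> real^'n \<Rightarrow> real) \<Rightarrow> 'n \<Rightarrow> 'n \<Rightarrow> real^'n \<Rightarrow> real" where
  "cov1 G T l i x = pd l (T i) x - (\<Sum>m\<in>UNIV. christoffel G m l i x * T m x)"

definition cov2 ::
  "('n::finite) metric \<Rightarrow> ('n \<Rightarrow> 'n \<Rightarrow> real^'n \<Rightarrow> real) \<Rightarrow> 'n \<Rightarrow> 'n \<Rightarrow> 'n \<Rightarrow> real^'n \<Rightarrow> real"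
  where
  "cov2 G T l i j x = pd l (T i j) x
     - (\<Sum>m\<in>UNIV. christoffel G m l i x * T m j x)
     - (\<Sum>m\<in>UNIV. christoffel G m l j x * T i m x)"

definition cov3 ::
  "('n::finite) metric \<Rightarrow> ('n \<Rightarrow> 'n \<Rightarrow> 'n \<Rightarrow> real^'n \<Rightarrow> real)
     \<Rightarrow> 'n \<Rightarrow> 'n \<Rightarrow> 'n \<Rightarrow> 'n \<Rightarrow> real^'n \<Rightarrow> real" where
  "cov3 G T l i j k x = pd l (T i j k) x
     - (\<Sum>m\<in>UNIV. christoffel G m l i x * T m j k x)
     - (\<Sum>m\<in>UNIV. christoffel G m l j x * T i m k x)
     - (\<Sum>m\<in>UNIV. christoffel G m l k x * T i j m x)"

definition gradient :: "('n::finite) metric \<Rightarrow> (real^'n \<Rightarrow> real) \<Rightarrow> real^'n \<Rightarrow> real^'n" where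
  "gradient G u x = (\<chi> i. \<Sum>j\<in>UNIV. upper G i j x * pd j u x)"

definition hessian :: "('n::finite) metric \<Rightarrow> (real^'n \<Rightarrow> real) \<Rightarrow> 'n \<Rightarrow> 'n \<Rightarrow> real^'n \<Rightarrow> real" where
  "hessian G u = cov1 G (\<lambda>j. pd j u)"

text \<open>With \<open>R(X,Y)Z = \<nabla>\<^sub>X\<nabla>\<^sub>YZ - \<nabla>\<^sub>Y\<nabla>\<^sub>XZ - \<nabla>\<^bsub>[X,Y]\<^esub>Z\<close>, this is
  \<open>R\<^bsub>ijkl\<^esub> = g(R(\<partial>\<^sub>i,\<partial>\<^sub>j)\<partial>\<^sub>l, \<partial>\<^sub>k)\<close>.  On the round unit sphere it equals
  \<open>g\<^bsub>ik\<^esub> g\<^bsub>jl\<^esub> - g\<^bsub>il\<^esub> g\<^bsub>jk\<^esub>\<close>, so that \<open>g\<^bsup>jl\<^esup> R\<^bsub>ijkl\<^esub>\<close> is the Ricci tensor with the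
  usual sign.\<close>

definition riemann :: "('n::finite) metric \<Rightarrow> 'n \<Rightarrow> 'n \<Rightarrow> 'n \<Rightarrow> 'n \<Rightarrow> real^'n \<Rightarrow> real" where
  "riemann G i j k l x =
     (\<Sum>m\<in>UNIV. lower G k m x *
        (pd i (christoffel G m j l) x - pd j (christoffel G m i l) x
         + (\<Sum>p\<in>UNIV. christoffel G m i p x * christoffel G p j l x)
         - (\<Sum>p\<in>UNIV. christoffel G m j p x * christoffel G p i l x)))"

definition ricci :: "('n::finite) metric \<Rightarrow> 'n \<Rightarrow> 'n \<Rightarrow> real^'n \<Rightarrow> real" where
  "ricci G i k x = (\<Sum>j\<in>UNIV. \<Sum>l\<in>UNIV. upper G j l x * riemann G i j k l x)"

definition scalar_curv :: "('n::finite) metric \<Rightarrow> real^'n \<Rightarrow> real" where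
  "scalar_curv G x = (\<Sum>i\<in>UNIV. \<Sum>k\<in>UNIV. upper G i k x * ricci G i k x)"

definition ricci_norm_sq :: "('n::finite) metric \<Rightarrow> real^'n \<Rightarrow> real" where
  "ricci_norm_sq G x =
     (\<Sum>i\<in>UNIV. \<Sum>j\<in>UNIV. \<Sum>k\<in>UNIV. \<Sum>l\<in>UNIV.
        upper G i k x * upper G j l x * ricci G i j x * ricci G k l x)"

definition weyl :: "('n::finite) metric \<Rightarrow> 'n \<Rightarrow> 'n \<Rightarrow> 'n \<Rightarrow> 'n \<Rightarrow> real^'n \<Rightarrow> real" where
  "weyl G i j k l x = (let n = real CARD('n) in
     riemann G i j k l x
     - 1 / (n - 2) * (lower G i k x * ricci G j l x - lower G i l x * ricci G j k x
                      - lower G j k x * ricci G i l x + lower G j l x * ricci G i k x)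
     + scalar_curv G x / ((n - 1) * (n - 2))
         * (lower G i k x * lower G j l x - lower G i l x * lower G j k x))"

definition cotton :: "('n::finite) metric \<Rightarrow> 'n \<Rightarrow> 'n \<Rightarrow> 'n \<Rightarrow> real^'n \<Rightarrow> real" where
  "cotton G i j k x = (let n = real CARD('n) in
     cov2 G (ricci G) i j k x - cov2 G (ricci G) j i k x
     - 1 / (2 * (n - 1)) * (lower G j k x * pd i (scalar_curv G) x
                            - lower G i k x * pd j (scalar_curv G) x))"

definition bach :: "('n::finite) metric \<Rightarrow> 'n \<Rightarrow> 'n \<Rightarrow> real^'n \<Rightarrow> real" where
  "bach G i j x = (let n = real CARD('n) in
     1 / (n - 2) *
       ((\<Sum>k\<in>UNIV. \<Sum>l\<in>UNIV. upper G k l x * cov3 G (cotton G) l k i j x)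
        + (\<Sum>k\<in>UNIV. \<Sum>l\<in>UNIV. \<Sum>a\<in>UNIV. \<Sum>b\<in>UNIV.
             ricci G k l x * upper G k a x * upper G l b x * weyl G i a j b x)))"

definition bach_form :: "('n::finite) metric \<Rightarrow> real^'n \<Rightarrow> real^'n \<Rightarrow> real^'n \<Rightarrow> real" where
  "bach_form G x v w = (\<Sum>i\<in>UNIV. \<Sum>j\<in>UNIV. bach G i j x * v $ i * w $ j)"

section \<open>Gradient \<open>\<rho>\<close>-Einstein solitons\<close>

definition gradient_rho_einstein_soliton ::
  "'m topology \<Rightarrow> ('m, 'n::finite) chart set \<Rightarrow> (('m, 'n) chart \<Rightarrow> 'n metric)
     \<Rightarrow> ('m \<Rightarrow> real) \<Rightarrow> real \<Rightarrow> real \<Rightarrow> bool" where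
  "gradient_rho_einstein_soliton M A g f \<rho> lam \<longleftrightarrow>
     smooth_manifold M A \<and> riemannian_metric A g \<and> smooth_function A f \<and>
     (\<forall>c\<in>A. \<forall>x\<in>chart_img c. \<forall>i j.
        ricci (g c) i j x + hessian (g c) (in_chart c f) i j x
          = (\<rho> * scalar_curv (g c) x + lam) * lower (g c) i j x)"

definition dR_wedge_df_zero ::
  "('m, 'n::finite) chart set \<Rightarrow> (('m, 'n) chart \<Rightarrow> 'n metric) \<Rightarrow> ('m \<Rightarrow> real) \<Rightarrow> bool" where
  "dR_wedge_df_zero A g f \<longleftrightarrow>
     (\<forall>c\<in>A. \<forall>x\<in>chart_img c. \<forall>i j.
        pd i (scalar_curv (g c)) x * pd j (in_chart c f) x
        - pd j (scalar_curv (g c)) x * pd i (in_chart c f) x = 0)"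

definition xi1 :: "real \<Rightarrow> ('n::finite) metric \<Rightarrow> (real^'n \<Rightarrow> real) \<Rightarrow> real^'n \<Rightarrow> real" where
  "xi1 \<rho> G u x =
     1 / 2 * (1 - 2 * (real CARD('n) - 1) * \<rho>)
       * (metric_form G x (gradient G (scalar_curv G) x) (gradient G u x)
          / metric_form G x (gradient G u x) (gradient G u x))"

definition mu :: "real \<Rightarrow> ('n::finite) metric \<Rightarrow> (real^'n \<Rightarrow> real) \<Rightarrow> real^'n \<Rightarrow> real" where
  "mu \<rho> G u x = (let n = real CARD('n); R = scalar_curv G x; \<xi> = xi1 \<rho> G u x in
     n * \<xi>\<^sup>2 - 2 * R * \<xi> - ((n - 1) * ricci_norm_sq G x - R\<^sup>2))"

end

theory Submission
  imports Defs
begin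

text \<open>
  Everything happens in one chart. Write \<open>F\<close> for the gradient of the potential \<open>f\<close>,
  \<open>A\<^bsub>ijk\<^esub> = \<nabla>\<^sub>iR\<^bsub>jk\<^esub> - \<nabla>\<^sub>jR\<^bsub>ik\<^esub>\<close> (\<open>ricci_curl\<close>), and \<open>\<alpha> = (1 - 2(n - 1)\<rho>)/2\<close>.

  The Ricci identity for \<open>df\<close>, in which the soliton equation replaces the Hessian by the Ricci
  tensor, expresses \<open>A\<^bsub>ijk\<^esub>\<close> by \<open>dR\<close> and the curvature contracted with the gradient
  (\<open>ricci_curl_eq\<close>). Its trace and the contracted second Bianchi identity give
  \<open>R\<^bsub>ik\<^esub>F\<^sup>k = \<alpha> \<nabla>\<^sub>iR\<close> (\<open>Ric_F\<close>). The right side is closed, and \<open>R\<^bsub>jk\<^esub> \<nabla>\<^sub>iF\<^sup>k\<close> is symmetric in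
  \<open>i\<close> and \<open>j\<close>, so differentiating and antisymmetrising yields \<open>A\<^bsub>ijk\<^esub>F\<^sup>k = 0\<close> (\<open>ricci_curl_F\<close>).
  Inserted in the first formula this says \<open>\<rho> dR \<and> df = 0\<close>, and for \<open>\<rho> = 0\<close> the wedge product
  vanishes by hypothesis. So at regular points \<open>dR\<close> is proportional to \<open>df\<close>, the gradient is an
  eigenvector of the Ricci tensor with eigenvalue \<open>\<xi>\<^sub>1\<close>, and \<open>C\<^bsub>ijk\<^esub>F\<^sup>k = 0\<close> (\<open>cotton_F\<close>).

  The identity \<open>C\<^bsub>kij\<^esub>F\<^sup>j = 0\<close> turns a derivative of the Cotton tensor into a derivative of \<open>F\<close>,
  which is again the Ricci tensor up to a multiple of the metric: \<open>F\<^sup>j \<nabla>\<^sup>kC\<^bsub>kij\<^esub> = R\<^sup>k\<^sup>jC\<^bsub>kij\<^esub>\<close>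
  (\<open>div_cotton_F\<close>). The gradient stands there in the last slot; it may be moved to the middle
  one because \<open>\<nabla>\<^sup>kC\<^bsub>ijk\<^esub> = 0\<close> and the cyclic sum of the Cotton tensor vanishes
  (\<open>div_cotton_last\<close>, \<open>div_cotton_sym\<close>). Hence \<open>(n - 2) B(\<nabla>f, \<cdot>)\<close> equals the algebraic
  expression \<open>R\<^sup>k\<^sup>iC\<^bsub>kji\<^esub> + R\<^sup>a\<^sup>bW\<^bsub>iajb\<^esub>F\<^sup>i\<close>. The two Riemann terms in it cancel, and what
  remains are \<open>R\<close>, \<open>|Ric|\<^sup>2\<close> and contractions of the Ricci tensor with one of its eigenvectors,
  which sum up to the multiple \<open>\<mu>\<close> (\<open>bach_F\<close>).
\<close>

section \<open>Calculus of smooth functions\<close>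

lemma frechet_has_pd:
  fixes u :: "real^'n::finite \<Rightarrow> real"
  assumes "u differentiable (at x)"
  shows "((\<lambda>t. u (x + t *\<^sub>R axis i 1)) has_real_derivative pd i u x) (at 0)"
proof -
  have "(u has_derivative frechet_derivative u (at x)) (at (x + 0 *\<^sub>R axis i 1))"
    using assms frechet_derivative_works by auto
  moreover have "((\<lambda>t::real. x + t *\<^sub>R axis i (1::real)) has_derivative (\<lambda>t. t *\<^sub>R axis i 1))
      (at 0)"
    by (auto intro!: derivative_eq_intros)
  ultimately have "((\<lambda>t. u (x + t *\<^sub>R axis i 1)) has_derivative
      (\<lambda>t. frechet_derivative u (at x) (t *\<^sub>R axis i 1))) (at 0)"
    using has_derivative_compose by blast
  moreover have "linear (frechet_derivative u (at x))"
    using assms linear_frechet_derivative by blast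
  ultimately show ?thesis
    by (simp add: has_field_derivative_def pd_def linear_scale mult_commute_abs)
qed

lemma pd_along_line:
  fixes u :: "real^'n::finite \<Rightarrow> real"
  assumes "u differentiable (at (y + s *\<^sub>R axis i 1))"
  shows "((\<lambda>t. u (y + t *\<^sub>R axis i 1)) has_real_derivative pd i u (y + s *\<^sub>R axis i 1)) (at s)"
proof -
  have "((\<lambda>t. u (y + s *\<^sub>R axis i 1 + t *\<^sub>R axis i 1)) has_real_derivative
      pd i u (y + s *\<^sub>R axis i 1)) (at 0)"
    by (rule frechet_has_pd[OF assms])
  then have "((\<lambda>t. u (y + (t + s) *\<^sub>R axis i 1)) has_real_derivative
      pd i u (y + s *\<^sub>R axis i 1)) (at 0)"
    by (simp add: scaleR_left_distrib add_ac)
  then show ?thesis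
    using DERIV_shift[of "\<lambda>t. u (y + t *\<^sub>R axis i 1)" _ 0 s] by simp
qed

lemma pd_eqI:
  assumes "(u has_derivative D) (at x)"
  shows "pd i u x = D (axis i 1)"
  using assms frechet_derivative_at pd_def by metis

lemma pd_const [simp]: "pd i (\<lambda>_. a) x = 0"
  by (rule pd_eqI[where D="\<lambda>_. 0", simplified]) simp

lemma pd_add:
  assumes "u differentiable (at x)" "v differentiable (at x)"
  shows "pd i (\<lambda>y. u y + v y) x = pd i u x + pd i v x"
  using assms unfolding frechet_derivative_works
  by (intro trans[OF pd_eqI[OF has_derivative_add]]) (auto simp: pd_def)

lemma pd_diff:
  assumes "u differentiable (at x)" "v differentiable (at x)"
  shows "pd i (\<lambda>y. u y - v y) x = pd i u x - pd i v x"
  using assms unfolding frechet_derivative_works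
  by (intro trans[OF pd_eqI[OF has_derivative_diff]]) (auto simp: pd_def)

lemma pd_minus:
  assumes "u differentiable (at x)"
  shows "pd i (\<lambda>y. - u y) x = - pd i u x"
  using assms unfolding frechet_derivative_works
  by (intro trans[OF pd_eqI[OF has_derivative_minus]]) (auto simp: pd_def)

lemma pd_mult:
  assumes "u differentiable (at x)" "v differentiable (at x)"
  shows "pd i (\<lambda>y. u y * v y) x = u x * pd i v x + pd i u x * v x"
  using assms unfolding frechet_derivative_works
  by (intro trans[OF pd_eqI[OF has_derivative_mult]]) (auto simp: pd_def)

lemma pd_sum:
  assumes "\<And>k. k \<in> K \<Longrightarrow> u k differentiable (at x)"
  shows "pd i (\<lambda>y. \<Sum>k\<in>K. u k y) x = (\<Sum>k\<in>K. pd i (u k) x)"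
  using assms unfolding frechet_derivative_works
  by (intro trans[OF pd_eqI[OF has_derivative_sum]]) (auto simp: pd_def)

lemma pd_inverse:
  assumes "u differentiable (at x)" "u x \<noteq> 0"
  shows "pd i (\<lambda>y. inverse (u y)) x = - (inverse (u x) * pd i u x * inverse (u x))"
  using pd_eqI[OF Deriv.has_derivative_inverse[OF assms(2) assms(1)[unfolded
      frechet_derivative_works]]]
  by (simp add: pd_def)

lemma differentiable_inverse_real:
  fixes u :: "real^'n::finite \<Rightarrow> real"
  assumes "u differentiable (at x)" "u x \<noteq> 0"
  shows "(\<lambda>y. inverse (u y)) differentiable (at x)"
  using Deriv.has_derivative_inverse[OF assms(2) assms(1)[unfolded frechet_derivative_works]]
  by (auto simp: differentiable_def)

lemma differentiable_cong_on_open: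
  assumes "open S" "x \<in> S" "\<And>y. y \<in> S \<Longrightarrow> u y = v y" "u differentiable (at x)"
  shows "v differentiable (at x)"
  using assms has_derivative_transform_within_open unfolding differentiable_def by blast

lemma pd_cong_on_open:
  fixes u v :: "real^'n::finite \<Rightarrow> real"
  assumes "open S" "x \<in> S" "\<And>y. y \<in> S \<Longrightarrow> u y = v y"
  shows "pd i u x = pd i v x"
proof -
  have "(u has_derivative D) (at x) \<longleftrightarrow> (v has_derivative D) (at x)" for D
    using assms has_derivative_transform_within_open[of u D x UNIV S v]
      has_derivative_transform_within_open[of v D x UNIV S u] by auto
  then show ?thesis unfolding pd_def frechet_derivative_def by simp
qed

text \<open>Smoothness up to a finite order is the form in which closure properties can be proved by
  induction on the order.\<close>

definition diff_upto :: "nat \<Rightarrow> (real^'n::finite) set \<Rightarrow> (real^'n \<Rightarrow> real) \<Rightarrow> bool" where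
  "diff_upto N S u \<longleftrightarrow> (\<forall>is. length is \<le> N \<longrightarrow> (\<forall>x\<in>S. iter_pd is u differentiable (at x)))"

lemma iter_pd_snoc: "iter_pd (is @ [i]) u = iter_pd is (pd i u)"
  by (induction "is") auto

lemma smooth_iff_diff_upto: "smooth_fun_on S u \<longleftrightarrow> (\<forall>N. diff_upto N S u)"
  unfolding smooth_fun_on_def diff_upto_def by auto

lemma diff_upto_0: "diff_upto 0 S u \<longleftrightarrow> (\<forall>x\<in>S. u differentiable (at x))"
  unfolding diff_upto_def by simp

text \<open>A longer \<open>iter_pd\<close> differentiates outermost, whereas the induction on the order needs the
  first derivative innermost; splitting the list of indices at its end exchanges the two views.\<close>

lemma diff_upto_Suc:
  "diff_upto (Suc N) S u \<longleftrightarrow> (\<forall>x\<in>S. u differentiable (at x)) \<and> (\<forall>i. diff_upto N S (pd i u))"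
proof
  assume A: "diff_upto (Suc N) S u"
  have "u differentiable (at x)" if "x \<in> S" for x
    using A that unfolding diff_upto_def by (metis iter_pd.simps(1) le0 list.size(3))
  moreover have "diff_upto N S (pd i u)" for i
    using A unfolding diff_upto_def
    by (metis Suc_le_mono iter_pd_snoc length_append_singleton)
  ultimately show "(\<forall>x\<in>S. u differentiable (at x)) \<and> (\<forall>i. diff_upto N S (pd i u))" by blast
next
  assume A: "(\<forall>x\<in>S. u differentiable (at x)) \<and> (\<forall>i. diff_upto N S (pd i u))"
  show "diff_upto (Suc N) S u"
    unfolding diff_upto_def
  proof (intro allI impI ballI)
    fix "is" :: "'a list" and x assume L: "length is \<le> Suc N" and x: "x \<in> S"
    show "iter_pd is u differentiable (at x)"
    proof (cases "is" rule: rev_cases)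
      case Nil then show ?thesis using A x by simp
    next
      case (snoc js i)
      then show ?thesis using A L x unfolding diff_upto_def by (simp add: iter_pd_snoc)
    qed
  qed
qed

lemma diff_upto_differentiable: "diff_upto N S u \<Longrightarrow> x \<in> S \<Longrightarrow> u differentiable (at x)"
  by (cases N) (auto simp: diff_upto_0 diff_upto_Suc)

lemma diff_upto_Suc_imp: "diff_upto (Suc N) S u \<Longrightarrow> diff_upto N S u"
  unfolding diff_upto_def by auto

lemma diff_upto_cong:
  assumes "open S" "\<And>y. y \<in> S \<Longrightarrow> u y = v y" "diff_upto N S u"
  shows "diff_upto N S v"
  using assms(2,3)
proof (induction N arbitrary: u v)
  case 0
  then show ?case using differentiable_cong_on_open[OF assms(1)] by (metis diff_upto_0)
next
  case (Suc N)
  have "pd i u y = pd i v y" if "y \<in> S" for i y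
    using pd_cong_on_open[OF assms(1) that] Suc.prems(1) by blast
  then have "diff_upto N S (pd i v)" for i
    using Suc.IH[of "pd i u" "pd i v"] Suc.prems(2) by (simp add: diff_upto_Suc)
  moreover have "v differentiable (at x)" if "x \<in> S" for x
    using differentiable_cong_on_open[OF assms(1) that Suc.prems(1)] Suc.prems(2) that
    by (simp add: diff_upto_Suc)
  ultimately show ?case by (simp add: diff_upto_Suc)
qed

lemma diff_upto_const: "diff_upto N S (\<lambda>_. a)"
proof -
  have "pd i (\<lambda>_. a) = (\<lambda>_. 0)" for i :: 'a and a by auto
  then show ?thesis by (induction N arbitrary: a) (auto simp: diff_upto_0 diff_upto_Suc)
qed

lemma diff_upto_add:
  assumes "open S"
  shows "diff_upto N S u \<Longrightarrow> diff_upto N S v \<Longrightarrow> diff_upto N S (\<lambda>x. u x + v x)"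
proof (induction N arbitrary: u v)
  case 0 then show ?case by (auto simp: diff_upto_0)
next
  case (Suc N)
  then have "diff_upto N S (\<lambda>x. pd i u x + pd i v x)" for i by (auto simp: diff_upto_Suc)
  then have "diff_upto N S (pd i (\<lambda>x. u x + v x))" for i
    by (rule diff_upto_cong[OF assms, rotated])
       (use Suc.prems in \<open>auto simp: pd_add diff_upto_differentiable\<close>)
  with Suc.prems show ?case by (auto simp: diff_upto_Suc)
qed

lemma diff_upto_mult:
  assumes "open S"
  shows "diff_upto N S u \<Longrightarrow> diff_upto N S v \<Longrightarrow> diff_upto N S (\<lambda>x. u x * v x)"
proof (induction N arbitrary: u v)
  case 0 then show ?case by (auto simp: diff_upto_0)
next
  case (Suc N)
  have uv: "diff_upto N S u" "diff_upto N S v"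
    using Suc.prems by (auto intro: diff_upto_Suc_imp)
  have "diff_upto N S (pd i u)" "diff_upto N S (pd i v)" for i
    using Suc.prems by (simp_all add: diff_upto_Suc)
  then have "diff_upto N S (\<lambda>x. u x * pd i v x + pd i u x * v x)" for i
    by (intro diff_upto_add[OF assms] Suc.IH uv)
  then have "diff_upto N S (pd i (\<lambda>x. u x * v x))" for i
    by (rule diff_upto_cong[OF assms, rotated])
       (use Suc.prems in \<open>auto simp: pd_mult diff_upto_differentiable\<close>)
  with Suc.prems show ?case by (auto simp: diff_upto_Suc)
qed

lemma diff_upto_inverse:
  assumes "open S" "\<And>x. x \<in> S \<Longrightarrow> u x \<noteq> 0"
  shows "diff_upto N S u \<Longrightarrow> diff_upto N S (\<lambda>x. inverse (u x))"
proof (induction N)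
  case 0
  then show ?case
    using assms(2) by (auto simp: diff_upto_0 intro!: differentiable_inverse_real)
next
  case (Suc N)
  have "diff_upto N S (\<lambda>x. inverse (u x))" "diff_upto N S (pd i u)" for i
    using Suc.IH[OF diff_upto_Suc_imp[OF Suc.prems]] Suc.prems by (simp_all add: diff_upto_Suc)
  then have "diff_upto N S (\<lambda>x. (-1) * ((inverse (u x) * pd i u x) * inverse (u x)))" for i
    by (intro diff_upto_mult[OF assms(1)] diff_upto_const)
  then have "diff_upto N S (pd i (\<lambda>x. inverse (u x)))" for i
    by (rule diff_upto_cong[OF assms(1), rotated])
       (use Suc.prems assms(2) in \<open>auto simp: pd_inverse diff_upto_differentiable\<close>)
  moreover have "(\<lambda>x. inverse (u x)) differentiable (at x)" if "x \<in> S" for x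
    by (rule differentiable_inverse_real[OF diff_upto_differentiable[OF Suc.prems that]
        assms(2)[OF that]])
  ultimately show ?case by (auto simp: diff_upto_Suc)
qed

lemma smooth_differentiable: "smooth_fun_on S u \<Longrightarrow> x \<in> S \<Longrightarrow> u differentiable (at x)"
  unfolding smooth_iff_diff_upto using diff_upto_differentiable by blast

lemma smooth_pd: "smooth_fun_on S u \<Longrightarrow> smooth_fun_on S (pd i u)"
  unfolding smooth_iff_diff_upto using diff_upto_Suc by blast

lemma smooth_const: "smooth_fun_on S (\<lambda>_. a)"
  unfolding smooth_iff_diff_upto using diff_upto_const by blast

lemma smooth_cong:
  assumes "open S" "\<And>y. y \<in> S \<Longrightarrow> u y = v y" "smooth_fun_on S u"
  shows "smooth_fun_on S v"
  using assms diff_upto_cong unfolding smooth_iff_diff_upto by blast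

lemma smooth_add:
  "open S \<Longrightarrow> smooth_fun_on S u \<Longrightarrow> smooth_fun_on S v \<Longrightarrow> smooth_fun_on S (\<lambda>x. u x + v x)"
  unfolding smooth_iff_diff_upto using diff_upto_add by blast

lemma smooth_mult:
  "open S \<Longrightarrow> smooth_fun_on S u \<Longrightarrow> smooth_fun_on S v \<Longrightarrow> smooth_fun_on S (\<lambda>x. u x * v x)"
  unfolding smooth_iff_diff_upto using diff_upto_mult by blast

lemma smooth_minus: "open S \<Longrightarrow> smooth_fun_on S u \<Longrightarrow> smooth_fun_on S (\<lambda>x. - u x)"
  using smooth_mult[OF _ smooth_const[of S "-1"], of u] by simp

lemma smooth_diff:
  "open S \<Longrightarrow> smooth_fun_on S u \<Longrightarrow> smooth_fun_on S v \<Longrightarrow> smooth_fun_on S (\<lambda>x. u x - v x)"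
  using smooth_add[OF _ _ smooth_minus, of S u v] by simp

lemma smooth_divide_const: "open S \<Longrightarrow> smooth_fun_on S u \<Longrightarrow> smooth_fun_on S (\<lambda>x. u x / a)"
  using smooth_mult[OF _ _ smooth_const[of S "inverse a"], of u] by (simp add: field_simps)

lemma smooth_sum:
  assumes "open S" "\<And>k. k \<in> K \<Longrightarrow> smooth_fun_on S (u k)"
  shows "smooth_fun_on S (\<lambda>x. \<Sum>k\<in>K. u k x)"
  using assms(2)
  by (induction K rule: infinite_finite_induct) (auto intro: smooth_const smooth_add[OF assms(1)])

lemma smooth_prod:
  assumes "open S" "\<And>k. k \<in> K \<Longrightarrow> smooth_fun_on S (u k)"
  shows "smooth_fun_on S (\<lambda>x. \<Prod>k\<in>K. u k x)"
  using assms(2)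
  by (induction K rule: infinite_finite_induct) (auto intro: smooth_const smooth_mult[OF assms(1)])

lemma smooth_inverse:
  assumes "open S" "\<And>x. x \<in> S \<Longrightarrow> u x \<noteq> 0" "smooth_fun_on S u"
  shows "smooth_fun_on S (\<lambda>x. inverse (u x))"
  using assms diff_upto_inverse unfolding smooth_iff_diff_upto by blast

lemma smooth_det:
  fixes B :: "real^'n::finite \<Rightarrow> real^'m::finite^'m"
  assumes "open S" "\<And>i j. smooth_fun_on S (\<lambda>x. B x $ i $ j)"
  shows "smooth_fun_on S (\<lambda>x. det (B x))"
  unfolding det_def
  by (intro smooth_sum[OF assms(1)] smooth_mult[OF assms(1)] smooth_const smooth_prod[OF assms(1)]
      assms(2))

lemma matrix_inv_right_left:
  fixes B :: "real^'m::finite^'m"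
  assumes "det B \<noteq> 0"
  shows "B ** matrix_inv B = mat 1" "matrix_inv B ** B = mat 1"
proof -
  have "\<exists>C. B ** C = mat 1 \<and> C ** B = mat 1"
    using assms by (simp add: invertible_det_nz[symmetric] invertible_def)
  then have "B ** matrix_inv B = mat 1 \<and> matrix_inv B ** B = mat 1"
    unfolding matrix_inv_def by (rule someI_ex)
  then show "B ** matrix_inv B = mat 1" "matrix_inv B ** B = mat 1" by auto
qed

text \<open>By Cramer's rule an entry of the inverse is a quotient of two determinants, hence a smooth
  function of smooth entries.\<close>

lemma matrix_inv_entry:
  fixes B :: "real^'m::finite^'m"
  assumes "det B \<noteq> 0"
  shows "matrix_inv B $ i $ j
    = det (\<chi> k l. if l = i then axis j 1 $ k else B $ k $ l) * inverse (det B)"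
proof -
  have "B *v (matrix_inv B *v axis j 1) = axis j 1"
    using assms by (simp add: matrix_vector_mul_assoc matrix_inv_right_left)
  then have "matrix_inv B *v axis j 1
      = (\<chi> k. det (\<chi> i l. if l = k then axis j 1 $ i else B $ i $ l) / det B)"
    using cramer[OF assms] by blast
  then show ?thesis
    by (metis (no_types, lifting) column_def divide_inverse matrix_vector_mul_component
        matrix_vector_mult_basis vec_lambda_beta)
qed

lemma smooth_matrix_inv:
  fixes B :: "real^'n::finite \<Rightarrow> real^'m::finite^'m"
  assumes "open S" "\<And>i j. smooth_fun_on S (\<lambda>x. B x $ i $ j)" "\<And>x. x \<in> S \<Longrightarrow> det (B x) \<noteq> 0"
  shows "smooth_fun_on S (\<lambda>x. matrix_inv (B x) $ i $ j)"
proof (rule smooth_cong[OF assms(1)])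
  have "smooth_fun_on S (\<lambda>x. (\<chi> k l. if l = i then axis j 1 $ k else B x $ k $ l) $ k $ l)" for k l
    by (cases "l = i") (auto intro: smooth_const assms(2))
  then show "smooth_fun_on S (\<lambda>x. det (\<chi> k l. if l = i then axis j 1 $ k else B x $ k $ l)
      * inverse (det (B x)))"
    by (intro smooth_mult[OF assms(1)] smooth_inverse[OF assms(1) assms(3)]
        smooth_det[OF assms(1) assms(2)] smooth_det[OF assms(1)])
qed (use assms(3) in \<open>auto simp: matrix_inv_entry\<close>)

text \<open>Symmetry of second derivatives: by the mean value theorem the second difference over a small
  square of side \<open>h\<close> is \<open>h\<^sup>2\<close> times a mixed derivative at some point of the square. The second
  difference is symmetric in \<open>i\<close> and \<open>j\<close>, so both mixed derivatives take a common value on the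
  square (at two different points), and continuity gives equality in the limit.\<close>

lemma second_difference:
  fixes u :: "real^'n::finite \<Rightarrow> real"
  assumes u: "smooth_fun_on S u" and h: "h > 0"
    and sq: "\<And>s t. 0 \<le> s \<Longrightarrow> s \<le> h \<Longrightarrow> 0 \<le> t \<Longrightarrow> t \<le> h
        \<Longrightarrow> x + s *\<^sub>R axis i 1 + t *\<^sub>R axis j 1 \<in> S"
  obtains s t where "0 \<le> s" "s \<le> h" "0 \<le> t" "t \<le> h"
    "u (x + h *\<^sub>R axis i 1 + h *\<^sub>R axis j 1) - u (x + h *\<^sub>R axis i 1)
      - u (x + h *\<^sub>R axis j 1) + u x
      = h * h * pd j (pd i u) (x + s *\<^sub>R axis i 1 + t *\<^sub>R axis j 1)"
proof -
  let ?e = "axis i (1::real)" and ?d = "axis j (1::real)"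
  have u1: "smooth_fun_on S (pd i u)" by (rule smooth_pd[OF u])
  have D: "((\<lambda>s. u (x + t *\<^sub>R ?d + s *\<^sub>R ?e)) has_real_derivative pd i u (x + t *\<^sub>R ?d
      + s *\<^sub>R ?e)) (at s)"
    if "0 \<le> s" "s \<le> h" "0 \<le> t" "t \<le> h" for s t
    by (rule pd_along_line) (use sq[OF that] smooth_differentiable[OF u] in \<open>simp add:
        algebra_simps\<close>)
  have D': "((\<lambda>s. u (x + h *\<^sub>R ?d + s *\<^sub>R ?e) - u (x + 0 *\<^sub>R ?d + s *\<^sub>R ?e)) has_real_derivative
      pd i u (x + h *\<^sub>R ?d + s *\<^sub>R ?e) - pd i u (x + 0 *\<^sub>R ?d + s *\<^sub>R ?e)) (at s)"
    if "0 \<le> s" "s \<le> h" for s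
    by (rule DERIV_diff) (rule D; use that h in simp)+
  obtain s where s: "0 < s" "s < h" and es:
    "(u (x + h *\<^sub>R ?d + h *\<^sub>R ?e) - u (x + 0 *\<^sub>R ?d + h *\<^sub>R ?e))
      - (u (x + h *\<^sub>R ?d + 0 *\<^sub>R ?e) - u (x + 0 *\<^sub>R ?d + 0 *\<^sub>R ?e))
      = (h - 0) * (pd i u (x + h *\<^sub>R ?d + s *\<^sub>R ?e) - pd i u (x + 0 *\<^sub>R ?d + s *\<^sub>R ?e))"
    using MVT2[OF h D'] by blast
  have E: "((\<lambda>t. pd i u (x + s *\<^sub>R ?e + t *\<^sub>R ?d)) has_real_derivative
      pd j (pd i u) (x + s *\<^sub>R ?e + t *\<^sub>R ?d)) (at t)" if "0 \<le> t" "t \<le> h" for t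
    by (rule pd_along_line) (use sq[of s t] s that smooth_differentiable[OF u1] in simp)
  obtain t where t: "0 < t" "t < h" and et:
    "pd i u (x + s *\<^sub>R ?e + h *\<^sub>R ?d) - pd i u (x + s *\<^sub>R ?e + 0 *\<^sub>R ?d)
      = (h - 0) * pd j (pd i u) (x + s *\<^sub>R ?e + t *\<^sub>R ?d)"
    using MVT2[OF h E] by blast
  show thesis
    by (rule that[of s t]) (use s t es et in \<open>simp_all add: algebra_simps\<close>)
qed

lemma pd_commute:
  fixes u :: "real^'n::finite \<Rightarrow> real"
  assumes S: "open S" "x \<in> S" and u: "smooth_fun_on S u"
  shows "pd i (pd j u) x = pd j (pd i u) x"
proof (rule ccontr)
  let ?v = "\<lambda>y. pd j (pd i u) y" and ?w = "\<lambda>y. pd i (pd j u) y"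
  assume ne: "?w x \<noteq> ?v x"
  define \<epsilon> where "\<epsilon> = \<bar>?w x - ?v x\<bar> / 2"
  have \<epsilon>: "\<epsilon> > 0" using ne by (simp add: \<epsilon>_def)
  have "isCont ?v x" "isCont ?w x"
    using S u by (auto intro!: differentiable_imp_continuous_within smooth_differentiable smooth_pd)
  then obtain d1 d2 where d: "d1 > 0" "d2 > 0"
    "\<And>y. dist y x < d1 \<Longrightarrow> dist (?v y) (?v x) < \<epsilon>" "\<And>y. dist y x < d2 \<Longrightarrow> dist (?w y) (?w x) < \<epsilon>"
    using \<epsilon> unfolding continuous_at_eps_delta by metis
  obtain d3 where d3: "d3 > 0" "ball x d3 \<subseteq> S"
    using S openE by blast
  \<comment> \<open>points of the square of side \<open>h\<close> have distance at most \<open>2 * h\<close> from \<open>x\<close>\<close>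
  define h where "h = min d1 (min d2 d3) / 3"
  have h: "h > 0" "2 * h < d1" "2 * h < d2" "2 * h < d3" using d d3 by (auto simp: h_def min_def)
  have near: "dist (x + s *\<^sub>R axis k 1 + t *\<^sub>R axis l 1) x \<le> 2 * h"
    if "0 \<le> s" "s \<le> h" "0 \<le> t" "t \<le> h" for s t :: real and k l :: 'n
  proof -
    have "dist (x + s *\<^sub>R axis k 1 + t *\<^sub>R axis l 1) x
        = norm (s *\<^sub>R axis k (1::real) + t *\<^sub>R axis l 1)"
      by (simp add: dist_norm algebra_simps)
    also have "\<dots> \<le> \<bar>s\<bar> + \<bar>t\<bar>" by (rule order_trans[OF norm_triangle_ineq]) simp
    finally show ?thesis using that by simp
  qed
  have inS: "x + s *\<^sub>R axis k 1 + t *\<^sub>R axis l 1 \<in> S"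
    if "0 \<le> s" "s \<le> h" "0 \<le> t" "t \<le> h" for s t :: real and k l :: 'n
    using near[OF that, of k l] h d3 by (auto simp: subset_iff dist_commute)
  obtain s t where st: "0 \<le> s" "s \<le> h" "0 \<le> t" "t \<le> h" and
    A: "u (x + h *\<^sub>R axis i 1 + h *\<^sub>R axis j 1) - u (x + h *\<^sub>R axis i 1)
      - u (x + h *\<^sub>R axis j 1) + u x = h * h * ?v (x + s *\<^sub>R axis i 1 + t *\<^sub>R axis j 1)"
    by (rule second_difference[OF u h(1), of x i j]) (rule inS)
  obtain s' t' where st': "0 \<le> s'" "s' \<le> h" "0 \<le> t'" "t' \<le> h" and
    B: "u (x + h *\<^sub>R axis j 1 + h *\<^sub>R axis i 1) - u (x + h *\<^sub>R axis j 1)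
      - u (x + h *\<^sub>R axis i 1) + u x = h * h * ?w (x + s' *\<^sub>R axis j 1 + t' *\<^sub>R axis i 1)"
    by (rule second_difference[OF u h(1), of x j i]) (rule inS)
  have "h * h * ?v (x + s *\<^sub>R axis i 1 + t *\<^sub>R axis j 1)
      = h * h * ?w (x + s' *\<^sub>R axis j 1 + t' *\<^sub>R axis i 1)"
    using A B by (simp add: add.commute add.left_commute algebra_simps)
  then have "?v (x + s *\<^sub>R axis i 1 + t *\<^sub>R axis j 1) = ?w (x + s' *\<^sub>R axis j 1 + t' *\<^sub>R axis i 1)"
    using h by simp
  moreover have "dist (?v (x + s *\<^sub>R axis i 1 + t *\<^sub>R axis j 1)) (?v x) < \<epsilon>"
    using near[OF st, of i j] h d by force
  moreover have "dist (?w (x + s' *\<^sub>R axis j 1 + t' *\<^sub>R axis i 1)) (?w x) < \<epsilon>"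
    using near[OF st', of j i] h d by force
  moreover have False if "a
      = b" "dist a v < \<bar>w - v\<bar> / 2" "dist b w < \<bar>w - v\<bar> / 2" for a b v w :: real
    using that unfolding dist_real_def by (auto simp: abs_if split: if_splits)
  ultimately show False unfolding \<epsilon>_def by blast
qed

section \<open>The Levi-Civita connection and the curvature tensor in a chart\<close>

text \<open>\<open>U\<close> plays the role of the image of a chart and \<open>G\<close> that of the metric in it.\<close>

locale metric_chart =
  fixes U :: "(real^'n::finite) set" and G :: "'n metric"
  assumes open_dom [simp]: "open U"
    and smooth_lower [simp]: "smooth_fun_on U (lower G i j)"
    and metric_symmetric: "x \<in> U \<Longrightarrow> transpose (G x) = G x"
    and metric_positive: "x \<in> U \<Longrightarrow> v \<noteq> 0 \<Longrightarrow> v \<bullet> (G x *v v) > 0"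
begin

abbreviation gl where "gl \<equiv> lower G"
abbreviation gu where "gu \<equiv> upper G"
abbreviation \<Gamma> where "\<Gamma> \<equiv> christoffel G"
abbreviation Ric where "Ric \<equiv> ricci G"
abbreviation smooth where "smooth \<equiv> smooth_fun_on U"

lemmas smooth_rules [simp] =
  smooth_pd smooth_const smooth_add[OF open_dom] smooth_mult[OF open_dom]
  smooth_minus[OF open_dom] smooth_diff[OF open_dom] smooth_divide_const[OF open_dom]
  smooth_sum[OF open_dom]

lemma gl_sym: assumes "x \<in> U" shows "gl i j x = gl j i x"
proof -
  have "transpose (G x) $ i $ j = G x $ j $ i" by (simp add: transpose_def)
  then show ?thesis using metric_symmetric[OF assms] by (simp add: lower_def)
qed

context
  fixes x assumes x: "x \<in> U"
begin

lemma pd_rules: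
  shows pd_add': "smooth u \<Longrightarrow> smooth v \<Longrightarrow> pd i (\<lambda>y. u y + v y) x = pd i u x + pd i v x"
    and pd_diff': "smooth u \<Longrightarrow> smooth v \<Longrightarrow> pd i (\<lambda>y. u y - v y) x = pd i u x - pd i v x"
    and pd_minus': "smooth u \<Longrightarrow> pd i (\<lambda>y. - u y) x = - pd i u x"
    and pd_mult': "smooth u \<Longrightarrow> smooth v \<Longrightarrow>
        pd i (\<lambda>y. u y * v y) x = u x * pd i v x + pd i u x * v x"
    and pd_sum': "(\<And>k. k \<in> K \<Longrightarrow> smooth (w k)) \<Longrightarrow>
        pd i (\<lambda>y. \<Sum>k\<in>K. w k y) x = (\<Sum>k\<in>K. pd i (w k) x)"
  by (rule pd_add pd_diff pd_minus pd_mult pd_sum; use x in \<open>blast intro: smooth_differentiable\<close>)+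

lemma pd_divide': "smooth u \<Longrightarrow> pd i (\<lambda>y. u y / a) x = pd i u x / a"
  using pd_mult'[of u "\<lambda>_. inverse a"] by (simp add: field_simps)

lemma pd_cong': "(\<And>y. y \<in> U \<Longrightarrow> u y = v y) \<Longrightarrow> pd i u x = pd i v x"
  using pd_cong_on_open[OF open_dom x] by blast

lemma pd_pd: "smooth u \<Longrightarrow> pd i (pd j u) x = pd j (pd i u) x"
  using pd_commute[OF open_dom x] by blast

lemma det_metric: "det (G x) \<noteq> 0"
proof
  assume "det (G x) = 0"
  then obtain v where "v \<noteq> 0" "G x *v v = 0"
    using matrix_left_invertible_ker[of "G x"] invertible_det_nz[of "G x"]
      invertible_left_inverse[of "G x"] by auto
  then show False using metric_positive[OF x, of v] by simp
qed

lemma gu_gl: "(\<Sum>k\<in>UNIV. gu i k x * gl k j x) = (if i = j then 1 else 0)"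
  and gl_gu: "(\<Sum>k\<in>UNIV. gl i k x * gu k j x) = (if i = j then 1 else 0)"
proof -
  have "(matrix_inv (G x) ** G x) $ i $ j = mat 1 $ i $ j" "(G x ** matrix_inv (G x)) $ i $ j
      = mat 1 $ i $ j"
    using matrix_inv_right_left[OF det_metric] by simp_all
  then show "(\<Sum>k\<in>UNIV. gu i k x * gl k j x) = (if i = j then 1 else 0)"
    "(\<Sum>k\<in>UNIV. gl i k x * gu k j x) = (if i = j then 1 else 0)"
    by (auto simp: matrix_matrix_mult_def lower_def upper_def mat_def)
qed

lemma lower_raise: "(\<Sum>k\<in>UNIV. gl i k x * (\<Sum>j\<in>UNIV. gu k j x * v j)) = v i"
proof -
  have "(\<Sum>k\<in>UNIV. gl i k x * (\<Sum>j\<in>UNIV. gu k j x * v j))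
      = (\<Sum>j\<in>UNIV. (\<Sum>k\<in>UNIV. gl i k x * gu k j x) * v j)"
    by (simp add: sum_distrib_left sum_distrib_right mult.assoc, subst sum.swap, rule refl)
  also have "\<dots> = v i" by (simp add: gl_gu if_distrib[of "\<lambda>a. a * _"] cong: if_cong)
  finally show ?thesis .
qed

lemma raise_lower: "(\<Sum>k\<in>UNIV. gu i k x * (\<Sum>j\<in>UNIV. gl k j x * v j)) = v i"
proof -
  have "(\<Sum>k\<in>UNIV. gu i k x * (\<Sum>j\<in>UNIV. gl k j x * v j))
      = (\<Sum>j\<in>UNIV. (\<Sum>k\<in>UNIV. gu i k x * gl k j x) * v j)"
    by (simp add: sum_distrib_left sum_distrib_right mult.assoc, subst sum.swap, rule refl)
  also have "\<dots> = v i" by (simp add: gu_gl if_distrib[of "\<lambda>a. a * _"] cong: if_cong)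
  finally show ?thesis .
qed

text \<open>Formulas that involve the inverse metric are verified after lowering an index, where only the
  metric and the identity matrix occur.\<close>

lemma lower_inject:
  assumes "\<And>i. (\<Sum>k\<in>UNIV. gl i k x * v k) = (\<Sum>k\<in>UNIV. gl i k x * w k)"
  shows "v i = w i"
  by (subst raise_lower[symmetric], subst assms, rule raise_lower)

lemma gu_sym: "gu i j x = gu j i x"
proof (rule lower_inject[of "\<lambda>i. gu i j x" "\<lambda>i. gu j i x"])
  fix k
  have "(\<Sum>l\<in>UNIV. gl k l x * gu j l x) = (\<Sum>l\<in>UNIV. gu j l x * gl l k x)"
    by (rule sum.cong) (simp_all add: gl_sym[OF x, of k] mult.commute)
  then show "(\<Sum>l\<in>UNIV. gl k l x * gu l j x) = (\<Sum>l\<in>UNIV. gl k l x * gu j l x)"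
    by (simp add: gu_gl gl_gu eq_commute)
qed

lemma pd_gl_sym: "pd l (gl i j) x = pd l (gl j i) x"
  by (rule pd_cong') (rule gl_sym)

lemma \<Gamma>_sym: "\<Gamma> m i j x = \<Gamma> m j i x"
  unfolding christoffel_def by (simp add: pd_gl_sym[of _ i j] add.commute)

lemma lower_\<Gamma>:
  "(\<Sum>m\<in>UNIV. gl k m x * \<Gamma> m i j x) = (pd i (gl j k) x + pd j (gl i k) x - pd k (gl i j) x) / 2"
  using lower_raise[of k "\<lambda>l. (pd i (gl j l) x + pd j (gl i l) x - pd l (gl i j) x) / 2"]
  unfolding christoffel_def by (simp add: sum_divide_distrib)

lemma metric_compatible:
  "pd i (gl k l) x = (\<Sum>m\<in>UNIV. gl k m x * \<Gamma> m i l x) + (\<Sum>m\<in>UNIV. gl l m x * \<Gamma> m i k x)"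
  unfolding lower_\<Gamma> by (simp add: pd_gl_sym[of _ l k] pd_gl_sym[of _ l i] pd_gl_sym[of _ k i]
      field_simps)

end

lemma smooth_upper [simp]: "smooth (gu i j)"
proof -
  have "smooth (\<lambda>x. matrix_inv (G x) $ i $ j)"
    by (rule smooth_matrix_inv[OF open_dom]) (use smooth_lower det_metric in \<open>auto simp:
        lower_def[abs_def]\<close>)
  then show ?thesis by (simp add: upper_def[abs_def])
qed

lemma smooth_\<Gamma> [simp]: "smooth (\<Gamma> k i j)"
  unfolding christoffel_def[abs_def] by simp

text \<open>The Riemann tensor \<open>R\<^sup>m\<^bsub>ijl\<^esub>\<close> with its third index raised, as it comes out of the commutator
  of covariant derivatives. It contains the Christoffel symbols but no metric, which keeps the
  Bianchi identity free of derivatives of the metric.\<close>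

definition rup :: "'n \<Rightarrow> 'n \<Rightarrow> 'n \<Rightarrow> 'n \<Rightarrow> real^'n \<Rightarrow> real" where
  "rup m i j l x = pd i (\<Gamma> m j l) x - pd j (\<Gamma> m i l) x
     + (\<Sum>p\<in>UNIV. \<Gamma> m i p x * \<Gamma> p j l x) - (\<Sum>p\<in>UNIV. \<Gamma> m j p x * \<Gamma> p i l x)"

lemma smooth_rup [simp]: "smooth (rup m i j l)"
  unfolding rup_def[abs_def] by simp

lemma riemann_rup: "riemann G i j k l x = (\<Sum>m\<in>UNIV. gl k m x * rup m i j l x)"
  unfolding riemann_def rup_def by simp

lemma smooth_riemann [simp]: "smooth (riemann G i j k l)"
  unfolding riemann_rup[abs_def] by simp

lemma smooth_ricci [simp]: "smooth (Ric i j)"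
  unfolding ricci_def[abs_def] by simp

lemma smooth_scalar [simp]: "smooth (scalar_curv G)"
  unfolding scalar_curv_def[abs_def] by simp

lemma smooth_cov2 [simp]: "(\<And>i j. smooth (T i j)) \<Longrightarrow> smooth (cov2 G T l i j)"
  unfolding cov2_def[abs_def] by simp

lemma smooth_cotton [simp]: "smooth (cotton G i j k)"
  unfolding cotton_def[abs_def] Let_def by simp

lemma rup_antisym: "rup m i j l x = - rup m j i l x"
  unfolding rup_def by simp

definition first_kind :: "'n \<Rightarrow> 'n \<Rightarrow> 'n \<Rightarrow> real^'n \<Rightarrow> real" where
  "first_kind k i j x = (\<Sum>m\<in>UNIV. gl k m x * \<Gamma> m i j x)"

context
  fixes x assumes x: "x \<in> U"
begin

text \<open>Differentiate \<open>g\<^bsub>ak\<^esub>g\<^sup>k\<^sup>l = \<delta>\<close> and use that the connection is metric.\<close>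

lemma pd_gu:
  "pd i (gu k l) x = - (\<Sum>m\<in>UNIV. \<Gamma> k i m x * gu m l x) - (\<Sum>m\<in>UNIV. \<Gamma> l i m x * gu k m x)"
proof (rule lower_inject[OF x, where v="\<lambda>k. pd i (gu k l) x" and
    w="\<lambda>k. - (\<Sum>m\<in>UNIV. \<Gamma> k i m x * gu m l x) - (\<Sum>m\<in>UNIV. \<Gamma> l i m x * gu k m x)"])
  fix a
  have "pd i (\<lambda>y. \<Sum>k\<in>UNIV. gl a k y * gu k l y) x = pd i (\<lambda>_. if a = l then 1 else 0) x"
    by (rule pd_cong'[OF x]) (simp add: gl_gu)
  then have "(\<Sum>k\<in>UNIV. gl a k x * pd i (gu k l) x) = - (\<Sum>k\<in>UNIV. pd i (gl a k) x * gu k l x)"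
    by (simp add: pd_rules[OF x] sum.distrib eq_neg_iff_add_eq_0)
  also have "(\<Sum>k\<in>UNIV. pd i (gl a k) x * gu k l x)
    = (\<Sum>k\<in>UNIV. \<Sum>m\<in>UNIV. gl a m x * \<Gamma> m i k x * gu k l x)
      + (\<Sum>k\<in>UNIV. gu l k x * (\<Sum>m\<in>UNIV. gl k m x * \<Gamma> m i a x))"
    by (simp add: metric_compatible[OF x] gu_sym[OF x, of l] sum.distrib algebra_simps
        sum_distrib_left sum_distrib_right)
  also have "(\<Sum>k\<in>UNIV. gu l k x * (\<Sum>m\<in>UNIV. gl k m x * \<Gamma> m i a x)) = \<Gamma> l i a x"
    by (rule raise_lower[OF x])
  finally have L: "(\<Sum>k\<in>UNIV. gl a k x * pd i (gu k l) x)
    = - (\<Sum>k\<in>UNIV. \<Sum>m\<in>UNIV. gl a m x * \<Gamma> m i k x * gu k l x) - \<Gamma> l i a x" by simp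
  have "(\<Sum>k\<in>UNIV. gl a k x * (\<Sum>m\<in>UNIV. \<Gamma> l i m x * gu k m x)) = \<Gamma> l i a x"
    using lower_raise[OF x, of a "\<lambda>m. \<Gamma> l i m x"] by (simp add: mult.commute)
  moreover have "(\<Sum>k\<in>UNIV. gl a k x * (\<Sum>m\<in>UNIV. \<Gamma> k i m x * gu m l x))
    = (\<Sum>k\<in>UNIV. \<Sum>m\<in>UNIV. gl a m x * \<Gamma> m i k x * gu k l x)"
    by (simp add: sum_distrib_left mult.assoc, rule sum.swap)
  ultimately show "(\<Sum>k\<in>UNIV. gl a k x * pd i (gu k l) x) = (\<Sum>k\<in>UNIV. gl a k x *
      (- (\<Sum>m\<in>UNIV. \<Gamma> k i m x * gu m l x) - (\<Sum>m\<in>UNIV. \<Gamma> l i m x * gu k m x)))"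
    unfolding L by (simp add: right_diff_distrib sum_subtractf sum_negf)
qed

lemma first_kind_sym: "first_kind k i j x = first_kind k j i x"
  unfolding first_kind_def by (simp add: \<Gamma>_sym[OF x, of _ i j])

lemma pd_gl_first_kind: "pd i (gl k l) x = first_kind k i l x + first_kind l i k x"
  unfolding first_kind_def by (rule metric_compatible[OF x])

lemma pd_first_kind:
  "pd l (first_kind k i j) x
      = (pd l (pd i (gl j k)) x + pd l (pd j (gl i k)) x - pd l (pd k (gl i j)) x) / 2"
proof -
  have "pd l (first_kind k i j) x
      = pd l (\<lambda>x. (pd i (gl j k) x + pd j (gl i k) x - pd k (gl i j) x) / 2) x"
    by (rule pd_cong'[OF x]) (simp add: first_kind_def lower_\<Gamma>)
  then show ?thesis by (simp add: pd_rules[OF x] pd_divide'[OF x])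
qed

text \<open>Written with symbols of the first kind, the curvature is a combination of second derivatives
  of the metric and of the symmetric bilinear expression in \<open>first_kind_\<Gamma>_sym\<close>; all its
  algebraic symmetries are read off from this form.\<close>

lemma riemann_first_kind:
  "riemann G i j k l x = pd i (first_kind k j l) x - pd j (first_kind k i l) x
     - (\<Sum>m\<in>UNIV. first_kind m i k x * \<Gamma> m j l x) + (\<Sum>m\<in>UNIV. first_kind m j k x * \<Gamma> m i l x)"
proof -
  have A: "(\<Sum>m\<in>UNIV. gl k m x * pd i (\<Gamma> m j l) x)
      + (\<Sum>m\<in>UNIV. gl k m x * (\<Sum>p\<in>UNIV. \<Gamma> m i p x * \<Gamma> p j l x))
     = pd i (first_kind k j l) x - (\<Sum>m\<in>UNIV. first_kind m i k x * \<Gamma> m j l x)" for i j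
  proof -
    have "pd i (first_kind k j l) x
        = (\<Sum>m\<in>UNIV. gl k m x * pd i (\<Gamma> m j l) x) + (\<Sum>m\<in>UNIV. pd i (gl k m) x * \<Gamma> m j l x)"
      unfolding first_kind_def[abs_def] by (simp add: pd_rules[OF x] sum.distrib)
    also have "(\<Sum>m\<in>UNIV. pd i (gl k m) x * \<Gamma> m j l x)
        = (\<Sum>m\<in>UNIV. first_kind k i m x * \<Gamma> m j l x) + (\<Sum>m\<in>UNIV. first_kind m i k x * \<Gamma> m j l x)"
      by (simp add: pd_gl_first_kind algebra_simps sum.distrib)
    also have "(\<Sum>m\<in>UNIV. first_kind k i m x * \<Gamma> m j l x)
        = (\<Sum>m\<in>UNIV. gl k m x * (\<Sum>p\<in>UNIV. \<Gamma> m i p x * \<Gamma> p j l x))"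
      unfolding first_kind_def by (simp add: sum_distrib_left sum_distrib_right mult.assoc, rule
          sum.swap)
    finally show ?thesis by simp
  qed
  have "riemann G i j k l x
      = ((\<Sum>m\<in>UNIV. gl k m x * pd i (\<Gamma> m j l) x)
      + (\<Sum>m\<in>UNIV. gl k m x * (\<Sum>p\<in>UNIV. \<Gamma> m i p x * \<Gamma> p j l x)))
     - ((\<Sum>m\<in>UNIV. gl k m x * pd j (\<Gamma> m i l) x)
         + (\<Sum>m\<in>UNIV. gl k m x * (\<Sum>p\<in>UNIV. \<Gamma> m j p x * \<Gamma> p i l x)))"
    unfolding riemann_rup rup_def by (simp add: right_diff_distrib distrib_left sum.distrib
        sum_subtractf)
  then show ?thesis unfolding A by simp
qed

lemma first_kind_\<Gamma>_sym:
  "(\<Sum>m\<in>UNIV. first_kind m i k x * \<Gamma> m j l x) = (\<Sum>m\<in>UNIV. first_kind m j l x * \<Gamma> m i k x)"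
proof -
  have "(\<Sum>m\<in>UNIV. first_kind m i k x * \<Gamma> m j l x)
      = (\<Sum>m\<in>UNIV. \<Sum>p\<in>UNIV. gl m p x * \<Gamma> p i k x * \<Gamma> m j l x)"
    unfolding first_kind_def by (simp add: sum_distrib_right)
  also have "\<dots> = (\<Sum>p\<in>UNIV. \<Sum>m\<in>UNIV. gl m p x * \<Gamma> p i k x * \<Gamma> m j l x)" by (rule sum.swap)
  also have "\<dots> = (\<Sum>p\<in>UNIV. \<Sum>m\<in>UNIV. gl p m x * \<Gamma> m j l x * \<Gamma> p i k x)"
    by (intro sum.cong refl) (simp add: gl_sym[OF x, of _ m for m])
  also have "\<dots> = (\<Sum>m\<in>UNIV. first_kind m j l x * \<Gamma> m i k x)"
    unfolding first_kind_def by (simp add: sum_distrib_right)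
  finally show ?thesis .
qed

lemma pd_pd_gl_sym: "pd a (pd b (gl i j)) x = pd b (pd a (gl j i)) x"
  by (subst pd_pd[OF x]) (simp, rule pd_cong'[OF x], rule pd_gl_sym)

lemma pd_pd_gl_commute: "pd a (pd b (gl i j)) x = pd b (pd a (gl i j)) x"
  by (rule pd_pd[OF x]) simp

lemma riemann_antisym_right: "riemann G i j k l x = - riemann G i j l k x"
  unfolding riemann_first_kind pd_first_kind
  by (simp only: pd_pd_gl_commute[of i j l k] pd_pd_gl_commute[of i j k l]
    first_kind_\<Gamma>_sym[of i k j l] first_kind_\<Gamma>_sym[of j k i l]) (simp add: field_simps)

lemma riemann_antisym_left: "riemann G i j k l x = - riemann G j i k l x"
  unfolding riemann_rup by (subst rup_antisym) (simp add: sum_negf)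

lemma riemann_pair: "riemann G i j k l x = riemann G k l i j x"
proof -
  have Q: "(\<Sum>m\<in>UNIV. first_kind m k i x * \<Gamma> m l j x) = (\<Sum>m\<in>UNIV. first_kind m i k x * \<Gamma> m j l x)"
    "(\<Sum>m\<in>UNIV. first_kind m l i x * \<Gamma> m k j x) = (\<Sum>m\<in>UNIV. first_kind m i l x * \<Gamma> m j k x)"
    by (simp_all only: first_kind_sym[of _ k i] first_kind_sym[of _ l i]
        \<Gamma>_sym[OF x, of _ l j] \<Gamma>_sym[OF x, of _ k j])
  show ?thesis
    unfolding riemann_first_kind pd_first_kind Q first_kind_\<Gamma>_sym[of j k i l]
    by (simp only: pd_pd_gl_commute[of i j l k] pd_pd_gl_commute[of k l j i]
      pd_pd_gl_sym[of i l j k] pd_pd_gl_sym[of i k j l] pd_pd_gl_sym[of j l i k]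
          pd_pd_gl_sym[of j k i l])
      (simp add: field_simps)
qed

lemma ricci_sym: "Ric i k x = Ric k i x"
proof -
  have "Ric i k x = (\<Sum>j\<in>UNIV. \<Sum>l\<in>UNIV. gu l j x * riemann G k l i j x)"
    unfolding ricci_def using riemann_pair gu_sym[OF x] by (intro sum.cong) auto
  also have "\<dots> = Ric k i x" unfolding ricci_def by (rule sum.swap)
  finally show ?thesis .
qed

text \<open>The Ricci tensor as a trace over an upper and a lower index. Such a trace commutes with
  covariant differentiation without any appeal to the metric.\<close>

lemma ricci_trace: "Ric i k x = (\<Sum>j\<in>UNIV. rup j j i k x)"
proof -
  have "gu j l x * riemann G i j k l x = gu j l x * riemann G j i l k x" for j l
    using riemann_antisym_left[of i j k l] riemann_antisym_right[of j i k l] by simp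
  then have "Ric i k x = (\<Sum>j\<in>UNIV. \<Sum>l\<in>UNIV. gu j l x * riemann G j i l k x)"
    unfolding ricci_def by (intro sum.cong refl)
  then have "Ric i k x = (\<Sum>j\<in>UNIV. \<Sum>l\<in>UNIV. gu j l x * (\<Sum>m\<in>UNIV. gl l m x * rup m j i k x))"
    by (simp only: riemann_rup)
  then show ?thesis by (simp add: raise_lower[OF x])
qed

end

end

section \<open>Bianchi and Ricci identities\<close>

definition mat_prod :: "('n::finite \<Rightarrow> 'n \<Rightarrow> real) \<Rightarrow> ('n \<Rightarrow> 'n \<Rightarrow> real) \<Rightarrow> 'n \<Rightarrow> 'n \<Rightarrow> real" where
  "mat_prod A B m l = (\<Sum>p\<in>UNIV. A m p * B p l)"

lemma mat_prod_assoc: "mat_prod (mat_prod A B) C m l = mat_prod A (mat_prod B C) m l"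
  unfolding mat_prod_def
  by (simp add: sum_distrib_left sum_distrib_right mult.assoc, rule sum.swap)

lemma sum_swap_12: "(\<Sum>a\<in>A. \<Sum>b\<in>B. \<Sum>c\<in>C. h a b c) = (\<Sum>b\<in>B. \<Sum>a\<in>A. \<Sum>c\<in>C. h a b c)"
  by (rule sum.swap)

lemma sum_swap_23: "(\<Sum>a\<in>A. \<Sum>b\<in>B. \<Sum>c\<in>C. h a b c) = (\<Sum>a\<in>A. \<Sum>c\<in>C. \<Sum>b\<in>B. h a b c)"
  by (rule sum.cong[OF refl], rule sum.swap)

lemma sum_swap_13: "(\<Sum>a\<in>A. \<Sum>b\<in>B. \<Sum>c\<in>C. h a b c) = (\<Sum>c\<in>C. \<Sum>b\<in>B. \<Sum>a\<in>A. h a b c)"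
  by (subst sum_swap_12, subst sum_swap_23, rule sum.swap)

context metric_chart
begin

text \<open>The components \<open>\<nabla>\<^sub>kR\<^sup>m\<^bsub>ijl\<^esub>\<close>; the index \<open>m\<close> is upper, hence its sign.\<close>

definition cov_rup :: "'n \<Rightarrow> 'n \<Rightarrow> 'n \<Rightarrow> 'n \<Rightarrow> 'n \<Rightarrow> real^'n \<Rightarrow> real" where
  "cov_rup k m i j l x = pd k (rup m i j l) x
     + (\<Sum>p\<in>UNIV. \<Gamma> m k p x * rup p i j l x) - (\<Sum>p\<in>UNIV. \<Gamma> p k i x * rup m p j l x)
     - (\<Sum>p\<in>UNIV. \<Gamma> p k j x * rup m i p l x) - (\<Sum>p\<in>UNIV. \<Gamma> p k l x * rup m i j p x)"

text \<open>The components \<open>R\<^bsub>ij\<^esub>\<^sup>m\<^sup>l\<close>. They are antisymmetric in \<open>m\<close> and \<open>l\<close>, and so is their covariant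
  derivative; this exchanges a divergence on the last index with one on the upper index of
  \<open>rup\<close>.\<close>

definition rup_up :: "'n \<Rightarrow> 'n \<Rightarrow> 'n \<Rightarrow> 'n \<Rightarrow> real^'n \<Rightarrow> real" where
  "rup_up m l i j x = (\<Sum>b\<in>UNIV. gu b l x * rup m i j b x)"

definition cov_rup_up :: "'n \<Rightarrow> 'n \<Rightarrow> 'n \<Rightarrow> 'n \<Rightarrow> 'n \<Rightarrow> real^'n \<Rightarrow> real" where
  "cov_rup_up k m l i j x = pd k (rup_up m l i j) x
     + (\<Sum>p\<in>UNIV. \<Gamma> m k p x * rup_up p l i j x) + (\<Sum>p\<in>UNIV. \<Gamma> l k p x * rup_up m p i j x)
     - (\<Sum>p\<in>UNIV. \<Gamma> p k i x * rup_up m l p j x) - (\<Sum>p\<in>UNIV. \<Gamma> p k j x * rup_up m l i p x)"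

definition cov_vector :: "('n \<Rightarrow> real^'n \<Rightarrow> real) \<Rightarrow> 'n \<Rightarrow> 'n \<Rightarrow> real^'n \<Rightarrow> real" where
  "cov_vector F l k x = pd l (F k) x + (\<Sum>m\<in>UNIV. \<Gamma> k l m x * F m x)"

context
  fixes x assumes x: "x \<in> U"
begin

lemma cov_rup_antisym: "cov_rup k m i j l x = - cov_rup k m j i l x"
proof -
  have "pd k (rup m i j l) x = - pd k (rup m j i l) x"
    by (rule trans[OF pd_cong'[OF x rup_antisym] pd_minus'[OF x]]) simp
  moreover have
    "(\<Sum>p\<in>UNIV. \<Gamma> m k p x * rup p i j l x) = - (\<Sum>p\<in>UNIV. \<Gamma> m k p x * rup p j i l x)"
    "(\<Sum>p\<in>UNIV. \<Gamma> p k i x * rup m p j l x) = - (\<Sum>p\<in>UNIV. \<Gamma> p k i x * rup m j p l x)"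
    "(\<Sum>p\<in>UNIV. \<Gamma> p k j x * rup m i p l x) = - (\<Sum>p\<in>UNIV. \<Gamma> p k j x * rup m p i l x)"
    "(\<Sum>p\<in>UNIV. \<Gamma> p k l x * rup m i j p x) = - (\<Sum>p\<in>UNIV. \<Gamma> p k l x * rup m j i p x)"
    by (subst rup_antisym, simp add: sum_negf)+
  ultimately show ?thesis
    unfolding cov_rup_def by simp
qed

text \<open>For fixed \<open>i\<close> and \<open>j\<close> the curvature is the matrix of the commutator of \<open>\<nabla>\<^sub>i\<close> and \<open>\<nabla>\<^sub>j\<close>, and
  the identity is the Jacobi identity: with \<open>M\<^sub>i\<close> the matrix of Christoffel symbols, all terms
  cancel by associativity of the matrix product, symmetry of second derivatives and symmetry of
  the connection.\<close>

lemma second_bianchi: "cov_rup k m i j l x + cov_rup i m j k l x + cov_rup j m k i l x = 0"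
proof -
  define M where "M i = (\<lambda>m l. \<Gamma> m i l x)" for i
  define dM where "dM k i = (\<lambda>m l. pd k (\<Gamma> m i l) x)" for k i
  have D: "pd k (rup m i j l) x = pd k (pd i (\<Gamma> m j l)) x - pd k (pd j (\<Gamma> m i l)) x
      + mat_prod (dM k i) (M j) m l + mat_prod (M i) (dM k j) m l - mat_prod (dM k j) (M i) m l
          - mat_prod (M j) (dM k i) m l"
    for k i j
    unfolding rup_def[abs_def] mat_prod_def M_def dM_def
        by (simp add: pd_rules[OF x] sum.distrib algebra_simps)
  have L: "(\<Sum>p\<in>UNIV. \<Gamma> m k p x * rup p i j l x)
      = mat_prod (M k) (dM i j) m l - mat_prod (M k) (dM j i) m l
      + mat_prod (M k) (mat_prod (M i) (M j)) m l
          - mat_prod (M k) (mat_prod (M j) (M i)) m l" for k i j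
    unfolding rup_def mat_prod_def M_def dM_def
        by (simp add: sum.distrib sum_subtractf distrib_left right_diff_distrib)
  have R: "(\<Sum>p\<in>UNIV. \<Gamma> p k l x * rup m i j p x)
      = mat_prod (dM i j) (M k) m l - mat_prod (dM j i) (M k) m l
      + mat_prod (M i) (mat_prod (M j) (M k)) m l
          - mat_prod (M j) (mat_prod (M i) (M k)) m l" for k i j
    unfolding mat_prod_assoc[symmetric]
    unfolding rup_def mat_prod_def M_def dM_def 
    by (simp add: sum.distrib sum_subtractf distrib_left right_diff_distrib mult.commute)
  \<comment> \<open>the Christoffel terms of the two form indices cancel in pairs over the cyclic sum\<close>
  have S: "(\<Sum>p\<in>UNIV. \<Gamma> p i k x * rup m j p l x) = - (\<Sum>p\<in>UNIV. \<Gamma> p k i x * rup m p j l x)" for i j k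
    by (subst rup_antisym) (simp add: sum_negf \<Gamma>_sym[OF x, of _ i k])
  show ?thesis
    unfolding cov_rup_def D L R S
    by (simp add: pd_pd[OF x, of _ i k] pd_pd[OF x, of _ j k] pd_pd[OF x, of _ j i])
qed

lemma cov_rup_trace: "(\<Sum>m\<in>UNIV. cov_rup k m m j l x) = cov2 G Ric k j l x"
proof -
  have "pd k (Ric j l) x = (\<Sum>m\<in>UNIV. pd k (rup m m j l) x)"
    by (subst pd_cong'[OF x ricci_trace]) (simp_all add: pd_rules[OF x])
  moreover have "(\<Sum>m\<in>UNIV. \<Sum>p\<in>UNIV. \<Gamma> m k p x * rup p m j l x)
      = (\<Sum>m\<in>UNIV. \<Sum>p\<in>UNIV. \<Gamma> p k m x * rup m p j l x)"
    by (rule sum.swap)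
  moreover have "(\<Sum>m\<in>UNIV. \<Sum>p\<in>UNIV. \<Gamma> p k j x * rup m m p l x) = (\<Sum>p\<in>UNIV. \<Gamma> p k j x * Ric p l x)"
    by (subst sum.swap) (simp add: ricci_trace[OF x] sum_distrib_left)
  moreover have "(\<Sum>m\<in>UNIV. \<Sum>p\<in>UNIV. \<Gamma> p k l x * rup m m j p x) = (\<Sum>p\<in>UNIV. \<Gamma> p k l x * Ric j p x)"
    by (subst sum.swap) (simp add: ricci_trace[OF x] sum_distrib_left)
  ultimately show ?thesis
    unfolding cov_rup_def cov2_def by (simp add: sum.distrib sum_subtractf)
qed

text \<open>The second Bianchi identity traced over the upper index.\<close>

lemma div_rup:
  "(\<Sum>m\<in>UNIV. cov_rup m m j k l x) = cov2 G Ric j k l x - cov2 G Ric k j l x"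
proof -
  have "(\<Sum>m\<in>UNIV. cov_rup k m m j l x + cov_rup m m j k l x + cov_rup j m k m l x) = 0"
    by (simp add: second_bianchi)
  then show ?thesis
    by (simp add: sum.distrib sum_subtractf cov_rup_trace cov_rup_antisym[of j _ k])
qed

lemma cov_rup_raise: "(\<Sum>b\<in>UNIV. gu b l x * cov_rup k m i j b x) = cov_rup_up k m l i j x"
proof -
  have "pd k (rup_up m l i j) x = (\<Sum>b\<in>UNIV. gu b l x * pd k (rup m i j b) x)
      + (\<Sum>b\<in>UNIV. pd k (gu b l) x * rup m i j b x)"
    unfolding rup_up_def[abs_def] by (simp add: pd_rules[OF x] sum.distrib)
  also have "(\<Sum>b\<in>UNIV. pd k (gu b l) x * rup m i j b x)
      = - (\<Sum>b\<in>UNIV. \<Sum>p\<in>UNIV. \<Gamma> b k p x * gu p l x * rup m i j b x)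
        - (\<Sum>b\<in>UNIV. \<Sum>p\<in>UNIV. \<Gamma> l k p x * gu b p x * rup m i j b x)"
    by (simp add: pd_gu[OF x] left_diff_distrib sum_subtractf sum_negf sum_distrib_right)
  also have "(\<Sum>b\<in>UNIV. \<Sum>p\<in>UNIV. \<Gamma> b k p x * gu p l x * rup m i j b x)
      = (\<Sum>b\<in>UNIV. gu b l x * (\<Sum>p\<in>UNIV. \<Gamma> p k b x * rup m i j p x))"
    by (subst sum.swap) (simp add: sum_distrib_left mult_ac)
  also have "(\<Sum>b\<in>UNIV. \<Sum>p\<in>UNIV. \<Gamma> l k p x * gu b p x * rup m i j b x)
      = (\<Sum>p\<in>UNIV. \<Gamma> l k p x * rup_up m p i j x)"
    by (subst sum.swap) (simp add: sum_distrib_left mult_ac rup_up_def)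
  finally have P: "pd k (rup_up m l i j) x = (\<Sum>b\<in>UNIV. gu b l x * pd k (rup m i j b) x)
     - (\<Sum>b\<in>UNIV. gu b l x * (\<Sum>p\<in>UNIV. \<Gamma> p k b x * rup m i j p x))
     - (\<Sum>p\<in>UNIV. \<Gamma> l k p x * rup_up m p i j x)" by simp
  have Q: "(\<Sum>b\<in>UNIV. gu b l x * (\<Sum>p\<in>UNIV. c p * rup (a p) (d p) (e p) b x))
      = (\<Sum>p\<in>UNIV. c p * rup_up (a p) l (d p) (e p) x)" for c :: "'n \<Rightarrow> real" and a d e
    unfolding rup_up_def by (simp add: sum_distrib_left, subst sum.swap) (simp add: mult_ac)
  show ?thesis
    unfolding cov_rup_up_def P cov_rup_def Q[symmetric]
    by (simp add: distrib_left right_diff_distrib sum.distrib sum_subtractf)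
qed

end

lemma rup_up_antisym: "x \<in> U \<Longrightarrow> rup_up m l i j x = - rup_up l m i j x"
proof -
  assume x: "x \<in> U"
  have R: "rup m i j b x = (\<Sum>a\<in>UNIV. gu m a x * riemann G i j a b x)" for m b
    unfolding riemann_rup by (simp add: raise_lower[OF x])
  have *: "rup_up m l i j x = (\<Sum>b\<in>UNIV. \<Sum>a\<in>UNIV. gu b l x * gu a m x * riemann G i j a b x)" for m l
    unfolding rup_up_def R by (simp add: sum_distrib_left mult.assoc gu_sym[OF x, of m])
  have "rup_up m l i j x = (\<Sum>b\<in>UNIV. \<Sum>a\<in>UNIV. - (gu a m x * gu b l x * riemann G i j b a x))"
    unfolding * by (intro sum.cong refl) (subst riemann_antisym_right[OF x], simp)
  also have "\<dots> = - rup_up l m i j x" unfolding * by (subst sum.swap) (simp add: sum_negf)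
  finally show ?thesis .
qed

lemma smooth_rup_up [simp]: "smooth (rup_up m l i j)"
  unfolding rup_up_def[abs_def] by simp

context
  fixes x assumes x: "x \<in> U"
begin

lemma cov_rup_up_antisym: "cov_rup_up k m l i j x = - cov_rup_up k l m i j x"
proof -
  have "pd k (rup_up m l i j) x = - pd k (rup_up l m i j) x"
    by (rule trans[OF pd_cong'[OF x rup_up_antisym] pd_minus'[OF x]]) simp_all
  moreover have
    "(\<Sum>p\<in>UNIV. \<Gamma> m k p x * rup_up p l i j x) = - (\<Sum>p\<in>UNIV. \<Gamma> m k p x * rup_up l p i j x)"
    "(\<Sum>p\<in>UNIV. \<Gamma> l k p x * rup_up m p i j x) = - (\<Sum>p\<in>UNIV. \<Gamma> l k p x * rup_up p m i j x)"
    "(\<Sum>p\<in>UNIV. \<Gamma> p k i x * rup_up m l p j x) = - (\<Sum>p\<in>UNIV. \<Gamma> p k i x * rup_up l m p j x)"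
    "(\<Sum>p\<in>UNIV. \<Gamma> p k j x * rup_up m l i p x) = - (\<Sum>p\<in>UNIV. \<Gamma> p k j x * rup_up l m i p x)"
    by (subst rup_up_antisym[OF x], simp add: sum_negf)+
  ultimately show ?thesis
    unfolding cov_rup_up_def by simp
qed

text \<open>The functions \<open>q\<close>, \<open>i\<close>, \<open>j\<close> of the summation index allow one of the lower indices of \<open>cov_rup\<close>
  to be the one that is contracted with the last index.\<close>

lemma trace_cov_rup_last:
  "(\<Sum>k\<in>UNIV. \<Sum>l\<in>UNIV. gu l k x * cov_rup (q k) m (i k) (j k) l x)
    = - (\<Sum>b\<in>UNIV. gu b m x * (\<Sum>k\<in>UNIV. cov_rup (q k) k (i k) (j k) b x))"
proof -
  have "(\<Sum>k\<in>UNIV. \<Sum>l\<in>UNIV. gu l k x * cov_rup (q k) m (i k) (j k) l x)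
      = - (\<Sum>k\<in>UNIV. \<Sum>b\<in>UNIV. gu b m x * cov_rup (q k) k (i k) (j k) b x)"
    unfolding cov_rup_raise[OF x] by (subst cov_rup_up_antisym) (simp add: sum_negf)
  also have "\<dots> = - (\<Sum>b\<in>UNIV. gu b m x * (\<Sum>k\<in>UNIV. cov_rup (q k) k (i k) (j k) b x))"
    by (subst sum.swap) (simp add: sum_distrib_left)
  finally show ?thesis .
qed

lemma trace_cov2:
  assumes T [simp]: "\<And>i j. smooth (T i j)"
  shows "(\<Sum>k\<in>UNIV. \<Sum>l\<in>UNIV. gu k l x * cov2 G T j k l x)
    = pd j (\<lambda>y. \<Sum>k\<in>UNIV. \<Sum>l\<in>UNIV. gu k l y * T k l y) x"
proof -
  have "pd j (\<lambda>y. \<Sum>k\<in>UNIV. \<Sum>l\<in>UNIV. gu k l y * T k l y) x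
     = (\<Sum>k\<in>UNIV. \<Sum>l\<in>UNIV. gu k l x * pd j (T k l) x)
         + (\<Sum>k\<in>UNIV. \<Sum>l\<in>UNIV. pd j (gu k l) x * T k l x)"
    by (simp add: pd_rules[OF x] sum.distrib)
  also have "(\<Sum>k\<in>UNIV. \<Sum>l\<in>UNIV. pd j (gu k l) x * T k l x)
     = - (\<Sum>k\<in>UNIV. \<Sum>l\<in>UNIV. \<Sum>m\<in>UNIV. \<Gamma> k j m x * gu m l x * T k l x)
       - (\<Sum>k\<in>UNIV. \<Sum>l\<in>UNIV. \<Sum>m\<in>UNIV. \<Gamma> l j m x * gu k m x * T k l x)"
    by (simp add: pd_gu[OF x] left_diff_distrib sum_subtractf sum_negf sum_distrib_right)
  also have "(\<Sum>k\<in>UNIV. \<Sum>l\<in>UNIV. \<Sum>m\<in>UNIV. \<Gamma> k j m x * gu m l x * T k l x)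
    = (\<Sum>k\<in>UNIV. \<Sum>l\<in>UNIV. \<Sum>m\<in>UNIV. gu k l x * (\<Gamma> m j k x * T m l x))"
    by (subst sum_swap_13) (simp add: mult_ac)
  also have "(\<Sum>k\<in>UNIV. \<Sum>l\<in>UNIV. \<Sum>m\<in>UNIV. \<Gamma> l j m x * gu k m x * T k l x)
    = (\<Sum>k\<in>UNIV. \<Sum>l\<in>UNIV. \<Sum>m\<in>UNIV. gu k l x * (\<Gamma> m j l x * T k m x))"
    by (subst sum_swap_23) (simp add: mult_ac)
  finally show ?thesis
    unfolding cov2_def by (simp add: sum_distrib_left right_diff_distrib sum_subtractf)
qed

lemma cov2_ricci_sym: "cov2 G Ric i j k x = cov2 G Ric i k j x"
proof -
  have "pd i (Ric j k) x = pd i (Ric k j) x" by (rule pd_cong'[OF x]) (rule ricci_sym)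
  then show ?thesis
    unfolding cov2_def by (simp add: ricci_sym[OF x, of j] ricci_sym[OF x, of _ k])
qed

text \<open>Trace \<open>div_rup\<close> once more, now with the metric: one side is \<open>\<nabla>R\<close> minus the divergence of the
  Ricci tensor, and the other is that divergence itself by antisymmetry in the last index pair.\<close>

lemma contracted_bianchi:
  "2 * (\<Sum>k\<in>UNIV. \<Sum>l\<in>UNIV. gu k l x * cov2 G Ric k j l x) = pd j (scalar_curv G) x"
proof -
  have "(\<Sum>m\<in>UNIV. \<Sum>k\<in>UNIV. \<Sum>l\<in>UNIV. gu l k x * cov_rup m m j k l x)
    = (\<Sum>m\<in>UNIV. \<Sum>b\<in>UNIV. gu b m x * cov2 G Ric m j b x)"
    unfolding trace_cov_rup_last[of "\<lambda>_. m" for m]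
    by (subst cov_rup_antisym[OF x]) (simp add: sum_negf cov_rup_trace[OF x])
  moreover have "(\<Sum>m\<in>UNIV. \<Sum>k\<in>UNIV. \<Sum>l\<in>UNIV. gu l k x * cov_rup m m j k l x)
    = (\<Sum>l\<in>UNIV. \<Sum>k\<in>UNIV. gu l k x * (cov2 G Ric j k l x - cov2 G Ric k j l x))"
    by (subst sum_swap_13) (simp add: sum_distrib_left[symmetric] div_rup[OF x])
  moreover have "(\<Sum>l\<in>UNIV. \<Sum>k\<in>UNIV. gu l k x * cov2 G Ric j k l x) = pd j (scalar_curv G) x"
    by (subst cov2_ricci_sym) (simp add: trace_cov2 scalar_curv_def[abs_def])
  moreover have "(\<Sum>m\<in>UNIV. \<Sum>b\<in>UNIV. gu b m x * cov2 G Ric m j b x)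
      = (\<Sum>k\<in>UNIV. \<Sum>l\<in>UNIV. gu k l x * cov2 G Ric k j l x)"
    by (subst gu_sym[OF x], rule refl)
  moreover have "(\<Sum>l\<in>UNIV. \<Sum>k\<in>UNIV. gu l k x * cov2 G Ric k j l x)
      = (\<Sum>k\<in>UNIV. \<Sum>l\<in>UNIV. gu k l x * cov2 G Ric k j l x)"
    by (subst sum.swap, subst gu_sym[OF x], rule refl)
  ultimately show ?thesis
    by (simp add: right_diff_distrib sum_subtractf)
qed

lemma ricci_identity:
  assumes w [simp]: "\<And>i. smooth (w i)"
  shows "cov2 G (cov1 G w) i j k x - cov2 G (cov1 G w) j i k x = - (\<Sum>m\<in>UNIV. rup m i j k x * w m x)"
proof -
  have D: "pd i (cov1 G w j k) x = pd i (pd j (w k)) x - (\<Sum>m\<in>UNIV. pd i (\<Gamma> m j k) x * w m x)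
     - (\<Sum>m\<in>UNIV. \<Gamma> m j k x * pd i (w m) x)" for i j
    unfolding cov1_def[abs_def] by (simp add: pd_rules[OF x] sum.distrib)
  have E: "(\<Sum>m\<in>UNIV. \<Gamma> m i k x * cov1 G w j m x) = (\<Sum>m\<in>UNIV. \<Gamma> m i k x * pd j (w m) x)
     - (\<Sum>m\<in>UNIV. (\<Sum>p\<in>UNIV. \<Gamma> m j p x * \<Gamma> p i k x) * w m x)" for i j
    unfolding cov1_def by (simp add: right_diff_distrib sum_subtractf sum_distrib_left
        sum_distrib_right)
      (subst sum.swap, simp add: mult_ac)
  show ?thesis
    unfolding cov2_def D E rup_def
    by (simp add: \<Gamma>_sym[OF x, of _ i j] pd_pd[OF x, of _ i j] left_diff_distrib distrib_right
        sum.distrib sum_subtractf)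
qed

text \<open>Product rule for the contraction with a vector field. The last sum appears because the left
  side is an ordinary derivative while one index of \<open>T\<close> stays free.\<close>

lemma leibniz2:
  assumes T [simp]: "\<And>i j. smooth (T i j)" and F [simp]: "\<And>i. smooth (F i)"
  shows "pd l (\<lambda>y. \<Sum>k\<in>UNIV. T j k y * F k y) x
    = (\<Sum>k\<in>UNIV. cov2 G T l j k x * F k x) + (\<Sum>k\<in>UNIV. T j k x * cov_vector F l k x)
      + (\<Sum>m\<in>UNIV. \<Gamma> m l j x * (\<Sum>k\<in>UNIV. T m k x * F k x))"
proof -
  have A: "(\<Sum>m\<in>UNIV. \<Gamma> m l j x * (\<Sum>k\<in>UNIV. T m k x * F k x))
      = (\<Sum>k\<in>UNIV. (\<Sum>m\<in>UNIV. \<Gamma> m l j x * T m k x) * F k x)"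
    by (simp add: sum_distrib_left sum_distrib_right mult.assoc, rule sum.swap)
  have B: "(\<Sum>k\<in>UNIV. T j k x * (\<Sum>m\<in>UNIV. \<Gamma> k l m x * F m x))
      = (\<Sum>k\<in>UNIV. (\<Sum>m\<in>UNIV. \<Gamma> m l k x * T j m x) * F k x)"
    by (simp add: sum_distrib_left sum_distrib_right mult_ac, rule sum.swap)
  show ?thesis
    unfolding A cov_vector_def cov2_def
    by (simp add: pd_rules[OF x] sum.distrib distrib_left left_diff_distrib sum_subtractf B)
qed

lemma leibniz3:
  assumes T [simp]: "\<And>i j k. smooth (T i j k)" and F [simp]: "\<And>i. smooth (F i)"
  shows "pd l (\<lambda>y. \<Sum>k\<in>UNIV. T i j k y * F k y) x
    = (\<Sum>k\<in>UNIV. cov3 G T l i j k x * F k x) + (\<Sum>k\<in>UNIV. T i j k x * cov_vector F l k x)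
      + (\<Sum>m\<in>UNIV. \<Gamma> m l i x * (\<Sum>k\<in>UNIV. T m j k x * F k x))
      + (\<Sum>m\<in>UNIV. \<Gamma> m l j x * (\<Sum>k\<in>UNIV. T i m k x * F k x))"
proof -
  have A: "(\<Sum>m\<in>UNIV. \<Gamma> m l i x * (\<Sum>k\<in>UNIV. T m j k x * F k x))
      = (\<Sum>k\<in>UNIV. (\<Sum>m\<in>UNIV. \<Gamma> m l i x * T m j k x) * F k x)"
    by (simp add: sum_distrib_left sum_distrib_right mult.assoc, rule sum.swap)
  have C: "(\<Sum>m\<in>UNIV. \<Gamma> m l j x * (\<Sum>k\<in>UNIV. T i m k x * F k x))
      = (\<Sum>k\<in>UNIV. (\<Sum>m\<in>UNIV. \<Gamma> m l j x * T i m k x) * F k x)"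
    by (simp add: sum_distrib_left sum_distrib_right mult.assoc, rule sum.swap)
  have B: "(\<Sum>k\<in>UNIV. T i j k x * (\<Sum>m\<in>UNIV. \<Gamma> k l m x * F m x))
      = (\<Sum>k\<in>UNIV. (\<Sum>m\<in>UNIV. \<Gamma> m l k x * T i j m x) * F k x)"
    by (simp add: sum_distrib_left sum_distrib_right mult_ac, rule sum.swap)
  show ?thesis
    unfolding A C cov_vector_def cov3_def
    by (simp add: pd_rules[OF x] sum.distrib distrib_left left_diff_distrib sum_subtractf B)
qed

lemma leibniz_rup:
  assumes w [simp]: "\<And>i. smooth (w i)"
  shows "cov3 G (\<lambda>i j l y. \<Sum>m\<in>UNIV. rup m i j l y * w m y) k i j l x
    = (\<Sum>m\<in>UNIV. cov_rup k m i j l x * w m x) + (\<Sum>m\<in>UNIV. rup m i j l x * cov1 G w k m x)"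
proof -
  have A: "(\<Sum>m\<in>UNIV. c m * (\<Sum>p\<in>UNIV. rup p (a m) (b m) (d m) x * w p x))
      = (\<Sum>p\<in>UNIV. (\<Sum>m\<in>UNIV. c m * rup p (a m) (b m) (d m) x) * w p x)"
    for c :: "'n \<Rightarrow> real" and a b d
    by (simp add: sum_distrib_left sum_distrib_right mult.assoc, rule sum.swap)
  have B: "(\<Sum>m\<in>UNIV. rup m i j l x * (\<Sum>p\<in>UNIV. \<Gamma> p k m x * w p x))
      = (\<Sum>m\<in>UNIV. (\<Sum>p\<in>UNIV. \<Gamma> m k p x * rup p i j l x) * w m x)"
    by (simp add: sum_distrib_left sum_distrib_right mult_ac, rule sum.swap)
  show ?thesis
    unfolding cov3_def A cov_rup_def cov1_def
    by (simp add: pd_rules[OF x] sum.distrib distrib_left distrib_right left_diff_distrib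
        right_diff_distrib
        sum_subtractf B)
qed

end

end

section \<open>Gradient \<open>\<rho>\<close>-Einstein solitons in a chart\<close>

context metric_chart
begin

text \<open>For the differential of a function this is its gradient.\<close>

definition raise :: "('n \<Rightarrow> real^'n \<Rightarrow> real) \<Rightarrow> 'n \<Rightarrow> real^'n \<Rightarrow> real" where
  "raise w k x = (\<Sum>j\<in>UNIV. gu k j x * w j x)"

definition ricup :: "'n \<Rightarrow> 'n \<Rightarrow> real^'n \<Rightarrow> real" where
  "ricup a b x = (\<Sum>l\<in>UNIV. \<Sum>m\<in>UNIV. gu a l x * gu b m x * Ric l m x)"

lemma smooth_raise [simp]: "(\<And>i. smooth (w i)) \<Longrightarrow> smooth (raise w k)"
  unfolding raise_def[abs_def] by simp

context
  fixes x assumes x: "x \<in> U"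
begin

lemma lower_raise': "(\<Sum>k\<in>UNIV. gl i k x * raise w k x) = w i x"
  unfolding raise_def by (rule lower_raise[OF x])

lemma cov_vector_raise:
  assumes w [simp]: "\<And>i. smooth (w i)"
  shows "cov_vector (raise w) l k x = (\<Sum>j\<in>UNIV. gu k j x * cov1 G w l j x)"
proof -
  have "pd l (raise w k) x
      = (\<Sum>j\<in>UNIV. gu k j x * pd l (w j) x) + (\<Sum>j\<in>UNIV. pd l (gu k j) x * w j x)"
    unfolding raise_def[abs_def] by (simp add: pd_rules[OF x] sum.distrib)
  also have "(\<Sum>j\<in>UNIV. pd l (gu k j) x * w j x) =
      - (\<Sum>j\<in>UNIV. \<Sum>m\<in>UNIV. \<Gamma> k l m x * gu m j x * w j x)
          - (\<Sum>j\<in>UNIV. \<Sum>m\<in>UNIV. \<Gamma> j l m x * gu k m x * w j x)"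
    by (simp add: pd_gu[OF x] left_diff_distrib sum_subtractf sum_negf sum_distrib_right)
  also have "(\<Sum>j\<in>UNIV. \<Sum>m\<in>UNIV. \<Gamma> k l m x * gu m j x * w j x) = (\<Sum>m\<in>UNIV. \<Gamma> k l m x * raise w m x)"
    unfolding raise_def by (subst sum.swap) (simp add: sum_distrib_left mult.assoc)
  also have "(\<Sum>j\<in>UNIV. \<Sum>m\<in>UNIV. \<Gamma> j l m x * gu k m x * w j x)
      = (\<Sum>j\<in>UNIV. gu k j x * (\<Sum>m\<in>UNIV. \<Gamma> m l j x * w m x))"
    by (subst sum.swap) (simp add: sum_distrib_left mult_ac)
  finally show ?thesis
    unfolding cov_vector_def cov1_def by (simp add: right_diff_distrib sum_subtractf)
qed

lemma cov2_gl: "cov2 G gl i j k x = 0"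
  unfolding cov2_def metric_compatible[OF x]
  by (simp add: gl_sym[OF x, of _ k] mult.commute)

lemma trace_gl_gu: "(\<Sum>j\<in>UNIV. \<Sum>k\<in>UNIV. gu j k x * gl j k x) = real CARD('n)"
proof -
  have "(\<Sum>j\<in>UNIV. \<Sum>k\<in>UNIV. gu j k x * gl j k x) = (\<Sum>j\<in>UNIV. \<Sum>k\<in>UNIV. gu j k x * gl k j x)"
    by (subst gl_sym[OF x]) (rule refl)
  then show ?thesis by (simp add: gu_gl[OF x])
qed

lemma gu_gl_contract: "(\<Sum>k\<in>UNIV. \<Sum>l\<in>UNIV. gu k l x * (v k * gl l j x)) = v j"
proof -
  have "(\<Sum>k\<in>UNIV. \<Sum>l\<in>UNIV. gu k l x * (v k * gl l j x))
      = (\<Sum>k\<in>UNIV. v k * (\<Sum>l\<in>UNIV. gu k l x * gl l j x))"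
    by (simp add: sum_distrib_left mult_ac)
  also have "\<dots> = v j" by (simp add: gu_gl[OF x] if_distrib[of "\<lambda>a. _ * a"] cong: if_cong)
  finally show ?thesis .
qed

lemma rup_lower: "(\<Sum>m\<in>UNIV. rup m i j k x * w m x) = (\<Sum>p\<in>UNIV. riemann G i j p k x * raise w p x)"
proof -
  have "(\<Sum>m\<in>UNIV. rup m i j k x * w m x)
      = (\<Sum>m\<in>UNIV. \<Sum>p\<in>UNIV. gl m p x * rup m i j k x * raise w p x)"
    by (subst lower_raise'[symmetric]) (simp add: sum_distrib_left mult_ac)
  also have "\<dots> = (\<Sum>p\<in>UNIV. \<Sum>m\<in>UNIV. gl p m x * rup m i j k x * raise w p x)"
    by (subst sum.swap, subst gl_sym[OF x], rule refl)
  also have "\<dots> = (\<Sum>p\<in>UNIV. riemann G i j p k x * raise w p x)"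
    by (simp add: riemann_rup sum_distrib_right)
  finally show ?thesis .
qed

text \<open>The curvature is antisymmetric in the two indices that are contracted with the same vector.\<close>

lemma rup_raise_zero: "(\<Sum>k\<in>UNIV. (\<Sum>m\<in>UNIV. rup m i j k x * w m x) * raise w k x) = 0" (is "?L = 0")
proof -
  have L: "?L = (\<Sum>k\<in>UNIV. \<Sum>p\<in>UNIV. riemann G i j p k x * raise w p x * raise w k x)"
    unfolding rup_lower by (simp add: sum_distrib_right)
  also have "\<dots> = (\<Sum>p\<in>UNIV. \<Sum>k\<in>UNIV. riemann G i j p k x * raise w p x * raise w k x)"
    by (rule sum.swap)
  also have "\<dots> = - ?L"
    unfolding L by (subst riemann_antisym_right[OF x]) (simp add: sum_negf mult_ac)
  finally show ?thesis by simp
qed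

lemma trace_rup:
  "(\<Sum>j\<in>UNIV. \<Sum>k\<in>UNIV. gu j k x * (\<Sum>m\<in>UNIV. rup m i j k x * w m x))
      = (\<Sum>b\<in>UNIV. Ric i b x * raise w b x)"
proof -
  have "(\<Sum>j\<in>UNIV. \<Sum>k\<in>UNIV. gu j k x * (\<Sum>m\<in>UNIV. rup m i j k x * w m x))
    = (\<Sum>m\<in>UNIV. \<Sum>k\<in>UNIV. \<Sum>j\<in>UNIV. gu k j x * rup m i j k x * w m x)"
    by (simp add: sum_distrib_left mult.assoc, subst sum_swap_13, subst gu_sym[OF x], rule refl)
  also have "\<dots> = (\<Sum>m\<in>UNIV. (\<Sum>j\<in>UNIV. rup_up m j i j x) * w m x)"
    unfolding rup_up_def by (subst sum_swap_23) (simp add: sum_distrib_right)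
  also have "\<dots> = (\<Sum>m\<in>UNIV. \<Sum>j\<in>UNIV. \<Sum>b\<in>UNIV. gu b m x * rup j j i b x * w m x)"
    by (subst rup_up_antisym[OF x], simp add: rup_up_def, subst rup_antisym)
       (simp add: sum_negf sum_distrib_right)
  also have "\<dots> = (\<Sum>b\<in>UNIV. \<Sum>j\<in>UNIV. \<Sum>m\<in>UNIV. gu b m x * rup j j i b x * w m x)"
    by (rule sum_swap_13)
  also have "\<dots> = (\<Sum>b\<in>UNIV. Ric i b x * raise w b x)"
    unfolding raise_def ricci_trace[OF x] by (simp add: sum_distrib_left
        sum_distrib_right mult_ac, subst sum_swap_23, rule refl)
  finally show ?thesis .
qed

lemma ricup_sym: "ricup a b x = ricup b a x"
  unfolding ricup_def by (subst sum.swap, subst ricci_sym[OF x]) (simp add: mult_ac)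

lemma ricup_lower: "(\<Sum>b\<in>UNIV. gl j b x * ricup a b x) = (\<Sum>l\<in>UNIV. gu a l x * Ric l j x)"
proof -
  have "(\<Sum>b\<in>UNIV. gl j b x * ricup a b x)
      = (\<Sum>b\<in>UNIV. gl j b x * (\<Sum>m\<in>UNIV. gu b m x * (\<Sum>l\<in>UNIV. gu a l x * Ric l m x)))"
    unfolding ricup_def by (subst sum.swap) (simp add: sum_distrib_left mult_ac)
  then show ?thesis by (simp add: lower_raise[OF x])
qed

lemma ricup_trace: "(\<Sum>a\<in>UNIV. \<Sum>b\<in>UNIV. gl a b x * ricup a b x) = scalar_curv G x"
  unfolding ricup_lower scalar_curv_def by (subst ricci_sym[OF x]) (rule refl)

lemma ricup_norm: "(\<Sum>a\<in>UNIV. \<Sum>b\<in>UNIV. ricup a b x * Ric a b x) = ricci_norm_sq G x"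
  unfolding ricup_def ricci_norm_sq_def by (simp add: sum_distrib_right sum_distrib_left mult_ac)

lemma ricup_covector: "(\<Sum>b\<in>UNIV. w b x * ricup a b x)
    = (\<Sum>l\<in>UNIV. gu a l x * (\<Sum>m\<in>UNIV. Ric l m x * raise w m x))"
proof -
  have "(\<Sum>b\<in>UNIV. w b x * ricup a b x)
      = (\<Sum>b\<in>UNIV. \<Sum>l\<in>UNIV. \<Sum>m\<in>UNIV. gu a l x * (Ric l m x * (gu m b x * w b x)))"
    unfolding ricup_def by (subst gu_sym[OF x, of _ b for b]) (simp add: sum_distrib_left mult_ac)
  also have "\<dots> = (\<Sum>l\<in>UNIV. \<Sum>m\<in>UNIV. \<Sum>b\<in>UNIV. gu a l x * (Ric l m x * (gu m b x * w b x)))"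
    by (subst sum.swap, subst sum_swap_23, rule refl)
  finally show ?thesis by (simp add: raise_def sum_distrib_left)
qed

lemma weyl_contract:
  "(\<Sum>i\<in>UNIV. v i * (\<Sum>k\<in>UNIV. \<Sum>l\<in>UNIV. \<Sum>a\<in>UNIV. \<Sum>b\<in>UNIV. Ric k l x * gu k a x * gu l b x * h i a b))
    = (\<Sum>i\<in>UNIV. \<Sum>a\<in>UNIV. \<Sum>b\<in>UNIV. v i * ricup a b x * h i a b)"
proof -
  have "(\<Sum>k\<in>UNIV. \<Sum>l\<in>UNIV. \<Sum>a\<in>UNIV. \<Sum>b\<in>UNIV. Ric k l x * gu k a x * gu l b x * h i a b)
     = (\<Sum>a\<in>UNIV. \<Sum>b\<in>UNIV. ricup a b x * h i a b)" for i
  proof -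
    have "(\<Sum>k\<in>UNIV. \<Sum>l\<in>UNIV. \<Sum>a\<in>UNIV. \<Sum>b\<in>UNIV. Ric k l x * gu k a x * gu l b x * h i a b)
      = (\<Sum>a\<in>UNIV. \<Sum>l\<in>UNIV. \<Sum>k\<in>UNIV. \<Sum>b\<in>UNIV. Ric k l x * gu k a x * gu l b x * h i a b)"
      by (rule sum_swap_13)
    also have "\<dots> = (\<Sum>a\<in>UNIV. \<Sum>b\<in>UNIV. \<Sum>k\<in>UNIV. \<Sum>l\<in>UNIV. Ric k l x * gu k a x * gu l b x * h i a b)"
      by (rule sum.cong[OF refl], rule sum_swap_13)
    finally show ?thesis
      by (simp add: ricup_def sum_distrib_left sum_distrib_right gu_sym[OF x, of _ a for a] mult_ac)
  qed
  then show ?thesis by (simp add: sum_distrib_left mult.assoc)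
qed

end

lemma gradient_raise: "gradient G w x $ k = raise (\<lambda>j. pd j w) k x"
  unfolding gradient_def raise_def by simp

lemma metric_form_gradient:
  assumes x: "x \<in> U"
  shows "metric_form G x (gradient G w x) v = (\<Sum>j\<in>UNIV. pd j w x * v $ j)"
proof -
  have "metric_form G x (gradient G w x) v
      = (\<Sum>j\<in>UNIV. (\<Sum>i\<in>UNIV. gl j i x * raise (\<lambda>j. pd j w) i x) * v $ j)"
    unfolding metric_form_def gradient_raise
    by (subst sum.swap, subst gl_sym[OF x]) (simp add: sum_distrib_right)
  then show ?thesis by (simp add: lower_raise'[OF x])
qed

lemma metric_form_pos:
  assumes x: "x \<in> U" and "v \<noteq> 0"
  shows "metric_form G x v v > 0"
proof -
  have "v \<bullet> (G x *v v) = metric_form G x v v"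
    unfolding metric_form_def inner_vec_def matrix_vector_mult_def lower_def
    by (simp add: sum_distrib_left mult_ac)
  then show ?thesis using metric_positive[OF assms] by simp
qed

end

text \<open>The arithmetic behind \<open>\<mu>\<close>, with \<open>q = n - 2\<close>: \<open>\<xi>\<close> is the eigenvalue of the gradient, \<open>\<sigma>\<close> the
  scalar curvature and \<open>N\<close> the squared norm of the Ricci tensor. The first summand comes from
  the Cotton tensor and the others from the Weyl tensor; the Riemann part \<open>t\<close> occurs in both
  with opposite signs.\<close>

lemma bach_coefficient:
  fixes q :: real
  assumes "q > 0"
  shows "1 / q * (- \<xi> / (q + 1) * (\<xi> - \<sigma>) * d + t
      + (- t - 1 / q * (N - 2 * \<xi>\<^sup>2 + \<sigma> * \<xi>) * d + \<sigma> / ((q + 1) * q) * (\<sigma> - \<xi>) * d))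
    = ((q + 2) * \<xi>\<^sup>2 - 2 * \<sigma> * \<xi> - ((q + 1) * N - \<sigma>\<^sup>2)) / ((q + 1) * q\<^sup>2) * d"
  using assms by (simp add: divide_simps) algebra

text \<open>The dimension enters as a real number \<open>n\<close>, so that \<open>\<alpha>\<close> and \<open>\<beta>\<close> below are plain numbers that do
  not depend on a type argument.\<close>

locale soliton_chart = metric_chart U G for U :: "(real^'n::finite) set" and G +
  fixes u :: "real^'n \<Rightarrow> real" and \<rho> lam n :: real
  assumes smooth_potential [simp]: "smooth_fun_on U u"
    and soliton: "x \<in> U \<Longrightarrow> Ric i j x + hessian G u i j x = (\<rho> * scalar_curv G x + lam) * gl i j x"
    and steady_wedge: "\<rho> = 0 \<Longrightarrow> x \<in> U \<Longrightarrow>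
        pd i (scalar_curv G) x * pd j u x = pd j (scalar_curv G) x * pd i u x"
    and n_def: "n = real CARD('n)" and dim: "n \<ge> 3"
begin

abbreviation S where "S \<equiv> scalar_curv G"
abbreviation C where "C \<equiv> cotton G"
abbreviation du :: "'n \<Rightarrow> real^'n \<Rightarrow> real" where "du j \<equiv> pd j u"
abbreviation F where "F \<equiv> raise du"

definition \<phi> :: "real^'n \<Rightarrow> real" where "\<phi> x = \<rho> * S x + lam"
text \<open>The factor in \<open>Ric(\<nabla>f) = \<alpha> \<nabla>R\<close>.\<close>

definition \<alpha> :: real where "\<alpha> = 1 / 2 - (n - 1) * \<rho>"
text \<open>The coefficient with which \<open>dR\<close> enters the Cotton tensor of a soliton; it equals
  \<open>- \<alpha> / (n - 1)\<close>.\<close>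

definition \<beta> :: real where "\<beta> = \<rho> - 1 / (2 * (n - 1))"

definition ricci_curl :: "'n \<Rightarrow> 'n \<Rightarrow> 'n \<Rightarrow> real^'n \<Rightarrow> real" where
  "ricci_curl i j k x = cov2 G Ric i j k x - cov2 G Ric j i k x"

lemma n_gt: "n > 2" using dim by simp

lemma smooth_\<phi> [simp]: "smooth \<phi>" unfolding \<phi>_def[abs_def] by simp

lemma cotton_ricci_curl: "C i j k x
    = ricci_curl i j k x - 1 / (2 * (n - 1)) * (gl j k x * pd i S x - gl i k x * pd j S x)"
  unfolding cotton_def ricci_curl_def Let_def n_def by simp

context
  fixes x assumes x: "x \<in> U"
begin

lemma hess: "cov1 G du i j x = \<phi> x * gl i j x - Ric i j x"
  using soliton[OF x, of i j] unfolding hessian_def \<phi>_def by simp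

lemma cov_vector_F: "cov_vector F l k x = \<phi> x * (if k
    = l then 1 else 0) - (\<Sum>m\<in>UNIV. gu k m x * Ric l m x)"
proof -
  have "(\<Sum>j\<in>UNIV. gu k j x * (\<phi> x * gl l j x)) = \<phi> x * (\<Sum>j\<in>UNIV. gu k j x * gl j l x)"
    by (subst gl_sym[OF x]) (simp add: sum_distrib_left mult_ac)
  then show ?thesis
    by (simp add: cov_vector_raise[OF x] hess right_diff_distrib sum_subtractf gu_gl[OF x])
qed

lemma cov2_hess: "cov2 G (cov1 G du) i j k x = pd i \<phi> x * gl j k x - cov2 G Ric i j k x"
proof -
  have "pd i (cov1 G du j k) x = pd i (\<lambda>y. \<phi> y * gl j k y - Ric j k y) x"
    by (rule pd_cong'[OF x]) (use soliton in \<open>simp add: hessian_def \<phi>_def algebra_simps\<close>)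
  then have "cov2 G (cov1 G du) i j k x
      = pd i \<phi> x * gl j k x + \<phi> x * cov2 G gl i j k x - cov2 G Ric i j k x"
    unfolding cov2_def hess by (simp add: pd_rules[OF x] right_diff_distrib sum_subtractf
        sum_distrib_left mult_ac)
  then show ?thesis by (simp add: cov2_gl[OF x])
qed

text \<open>The Ricci identity for the differential of the potential, with the Hessian eliminated by the
  soliton equation.\<close>

lemma ricci_curl_eq: "ricci_curl i j k x
    = \<rho> * (pd i S x * gl j k x - pd j S x * gl i k x) + (\<Sum>m\<in>UNIV. rup m i j k x * du m x)"
proof -
  have "pd i \<phi> x = \<rho> * pd i S x" for i
    unfolding \<phi>_def[abs_def] by (simp add: pd_rules[OF x])
  then show ?thesis
    using ricci_identity[OF x, of du i j k] unfolding cov2_hess ricci_curl_def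
        by (simp add: algebra_simps)
qed

lemma trace_ricci_curl: "(\<Sum>j\<in>UNIV. \<Sum>k\<in>UNIV. gu j k x * ricci_curl i j k x) = pd i S x / 2"
proof -
  have "(\<Sum>j\<in>UNIV. \<Sum>k\<in>UNIV. gu j k x * cov2 G Ric i j k x) = pd i S x"
    by (simp add: trace_cov2[OF x] scalar_curv_def[abs_def])
  then show ?thesis
    unfolding ricci_curl_def using contracted_bianchi[OF x, of i]
        by (simp add: right_diff_distrib sum_subtractf)
qed

text \<open>The trace of \<open>ricci_curl_eq\<close>, the left side being half of \<open>\<nabla>R\<close> by the contracted Bianchi
  identity.\<close>

lemma Ric_F: "(\<Sum>k\<in>UNIV. Ric i k x * F k x) = \<alpha> * pd i S x"
proof -
  define H where "H j k = (\<Sum>m\<in>UNIV. rup m i j k x * du m x)" for j k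
  have "(\<Sum>j\<in>UNIV. \<Sum>k\<in>UNIV. gu j k x * ricci_curl i j k x)
      = \<rho> * (pd i S x * (\<Sum>j\<in>UNIV. \<Sum>k\<in>UNIV. gu j k x * gl j k x)
         - (\<Sum>j\<in>UNIV. \<Sum>k\<in>UNIV. gu j k x * (pd j S x * gl k i x)))
        + (\<Sum>j\<in>UNIV. \<Sum>k\<in>UNIV. gu j k x * H j k)"
    unfolding ricci_curl_eq gl_sym[OF x, of i] H_def[symmetric]
    by (simp add: distrib_left right_diff_distrib sum.distrib sum_subtractf
        sum_distrib_left mult_ac)
  moreover have "(\<Sum>j\<in>UNIV. \<Sum>k\<in>UNIV. gu j k x * H j k) = (\<Sum>k\<in>UNIV. Ric i k x * F k x)"
    unfolding H_def by (rule trace_rup[OF x])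
  ultimately show ?thesis
    unfolding trace_ricci_curl trace_gl_gu[OF x, folded n_def] gu_gl_contract[OF x] \<alpha>_def
    by (simp add: algebra_simps)
qed

end

context
  fixes x assumes x: "x \<in> U"
begin

lemma Ric_cov_vector_F_sym:
  "(\<Sum>k\<in>UNIV. Ric j k x * cov_vector F i k x) = (\<Sum>k\<in>UNIV. Ric i k x * cov_vector F j k x)"
proof -
  have "(\<Sum>k\<in>UNIV. Ric j k x * cov_vector F i k x)
      = \<phi> x * Ric j i x - (\<Sum>k\<in>UNIV. \<Sum>m\<in>UNIV. gu k m x * Ric j k x * Ric i m x)" for i j
    by (simp add: cov_vector_F[OF x] right_diff_distrib sum_subtractf sum_distrib_left mult_ac
        if_distrib[of "\<lambda>a. _ * a"] cong: if_cong)
  moreover have "(\<Sum>k\<in>UNIV. \<Sum>m\<in>UNIV. gu k m x * Ric j k x * Ric i m x)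
      = (\<Sum>k\<in>UNIV. \<Sum>m\<in>UNIV. gu k m x * Ric i k x * Ric j m x)"
    by (subst sum.swap, subst gu_sym[OF x]) (simp add: mult_ac)
  ultimately show ?thesis by (simp add: ricci_sym[OF x, of i j])
qed

text \<open>Take the curl of \<open>Ric_F\<close>: second derivatives of \<open>R\<close> are symmetric, and so is the contribution
  of \<open>\<nabla>F\<close>, because \<open>\<nabla>F\<close> is a multiple of the identity minus the Ricci tensor.\<close>

lemma ricci_curl_F: "(\<Sum>k\<in>UNIV. ricci_curl i j k x * F k x) = 0"
proof -
  have D: "pd i (\<lambda>y. \<Sum>k\<in>UNIV. Ric j k y * F k y) x = \<alpha> * pd i (pd j S) x" for i j
    by (subst pd_cong'[OF x Ric_F]) (simp_all add: pd_rules[OF x])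
  have L: "pd i (\<lambda>y. \<Sum>k\<in>UNIV. Ric j k y * F k y) x
    = (\<Sum>k\<in>UNIV. cov2 G Ric i j k x * F k x) + (\<Sum>k\<in>UNIV. Ric j k x * cov_vector F i k x)
      + (\<Sum>m\<in>UNIV. \<Gamma> m i j x * (\<Sum>k\<in>UNIV. Ric m k x * F k x))" for i j
    by (rule leibniz2[OF x]) simp_all
  have "(\<Sum>k\<in>UNIV. cov2 G Ric i j k x * F k x) = (\<Sum>k\<in>UNIV. cov2 G Ric j i k x * F k x)"
    using D[of i j, unfolded L] D[of j i, unfolded L]
        pd_pd[OF x, of S i j] Ric_cov_vector_F_sym[of i j]
    by (simp add: \<Gamma>_sym[OF x, of _ i j])
  then show ?thesis unfolding ricci_curl_def by (simp add: left_diff_distrib sum_subtractf)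
qed

text \<open>Contracting \<open>ricci_curl_eq\<close> with the gradient kills the left side and the curvature term. This
  determines the wedge product only for nonzero \<open>\<rho>\<close>; for \<open>\<rho> = 0\<close> it is an assumption.\<close>

lemma dS_wedge_du: "pd i S x * du j x = pd j S x * du i x"
proof (cases "\<rho> = 0")
  case True
  then show ?thesis using steady_wedge x by blast
next
  case False
  have "(\<Sum>k\<in>UNIV. ricci_curl i j k x * F k x) = \<rho> * (pd i S x * (\<Sum>k\<in>UNIV. gl j k x * F k x)
      - pd j S x * (\<Sum>k\<in>UNIV. gl i k x * F k x))
          + (\<Sum>k\<in>UNIV. (\<Sum>m\<in>UNIV. rup m i j k x * du m x) * F k x)"
    unfolding ricci_curl_eq[OF x]
    by (simp add: distrib_left distrib_right left_diff_distrib right_diff_distrib sum.distrib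
        sum_subtractf sum_distrib_left mult_ac)
  then show ?thesis using False by (simp add: ricci_curl_F rup_raise_zero[OF x, of _ _ du]
      lower_raise'[OF x])
qed

lemma cotton_F: "(\<Sum>k\<in>UNIV. C i j k x * F k x) = 0"
proof -
  have "(\<Sum>k\<in>UNIV. C i j k x * F k x) = (\<Sum>k\<in>UNIV. ricci_curl i j k x * F k x)
     - 1 / (2 * (n - 1)) * (pd i S x * (\<Sum>k\<in>UNIV. gl j k x * F k x)
         - pd j S x * (\<Sum>k\<in>UNIV. gl i k x * F k x))"
    unfolding cotton_ricci_curl
    by (simp add: left_diff_distrib right_diff_distrib sum_subtractf sum_distrib_left mult_ac)
  then show ?thesis using dS_wedge_du[of i j] by (simp add: ricci_curl_F lower_raise'[OF x])
qed

lemma cotton_eq: "C i j k x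
    = \<beta> * (pd i S x * gl j k x - pd j S x * gl i k x) + (\<Sum>m\<in>UNIV. rup m i j k x * du m x)"
  unfolding cotton_ricci_curl ricci_curl_eq[OF x] \<beta>_def by (simp add: algebra_simps)

lemma cotton_antisym: "C i j k x = - C j i k x"
  unfolding cotton_ricci_curl ricci_curl_def by (simp add: algebra_simps)

lemma cotton_cyclic: "C k i j x = C k j i x - C i j k x"
  unfolding cotton_ricci_curl ricci_curl_def
  by (simp add: cov2_ricci_sym[OF x, of k] cov2_ricci_sym[OF x, of i j] cov2_ricci_sym[OF x, of j i]
      gl_sym[OF x, of j] gl_sym[OF x, of i k] algebra_simps)

lemma cotton_trace: "(\<Sum>k\<in>UNIV. \<Sum>j\<in>UNIV. gu k j x * C i k j x) = 0"
proof -
  have "(\<Sum>k\<in>UNIV. \<Sum>j\<in>UNIV. gu k j x * C i k j x) = (\<Sum>k\<in>UNIV. \<Sum>j\<in>UNIV. gu k j x * ricci_curl i k j x)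
     - 1 / (2 * (n - 1)) * (pd i S x * (\<Sum>k\<in>UNIV. \<Sum>j\<in>UNIV. gu k j x * gl k j x)
         - (\<Sum>k\<in>UNIV. \<Sum>j\<in>UNIV. gu k j x * (pd k S x * gl j i x)))"
    unfolding cotton_ricci_curl gl_sym[OF x, of i]
    by (simp add: right_diff_distrib sum_subtractf sum_distrib_left mult_ac)
  also have "\<dots> = pd i S x / 2 - 1 / (2 * (n - 1)) * (pd i S x * n - pd i S x)"
    unfolding trace_ricci_curl[OF x] trace_gl_gu[OF x, folded n_def] gu_gl_contract[OF x] ..
  also have "\<dots> = 0" using n_gt by (simp add: field_simps)
  finally show ?thesis .
qed

end

context
  fixes x assumes x: "x \<in> U"
begin

text \<open>The Cotton tensor vanishes identically on the gradient in its last slot, so its derivative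
  there is compensated by the derivative of the gradient.\<close>

lemma cov3_cotton_F:
  "(\<Sum>j\<in>UNIV. cov3 G C l k i j x * F j x) = - (\<Sum>j\<in>UNIV. C k i j x * cov_vector F l j x)"
proof -
  have "pd l (\<lambda>y. \<Sum>j\<in>UNIV. C k i j y * F j y) x = 0"
    by (subst pd_cong'[OF x cotton_F]) simp_all
  then show ?thesis
    using leibniz3[OF x, of C F l k i] by (simp add: cotton_F[OF x])
qed

text \<open>The part of \<open>\<nabla>F\<close> that is a multiple of the identity contributes the trace of the Cotton
  tensor, which is zero.\<close>

lemma div_cotton_F:
  "(\<Sum>j\<in>UNIV. (\<Sum>k\<in>UNIV. \<Sum>l\<in>UNIV. gu k l x * cov3 G C l k i j x) * F j x)
    = (\<Sum>k\<in>UNIV. \<Sum>j\<in>UNIV. ricup k j x * C k i j x)"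
proof -
  have "(\<Sum>j\<in>UNIV. (\<Sum>k\<in>UNIV. \<Sum>l\<in>UNIV. gu k l x * cov3 G C l k i j x) * F j x)
      = (\<Sum>k\<in>UNIV. \<Sum>l\<in>UNIV. gu k l x * (\<Sum>j\<in>UNIV. cov3 G C l k i j x * F j x))"
    by (simp add: sum_distrib_left sum_distrib_right mult.assoc, subst sum.swap, subst
        sum_swap_23, rule refl)
  also have "\<dots> = - \<phi> x * (\<Sum>k\<in>UNIV. \<Sum>l\<in>UNIV. gu k l x * C k i l x)
      + (\<Sum>k\<in>UNIV. \<Sum>l\<in>UNIV. \<Sum>j\<in>UNIV. \<Sum>m\<in>UNIV. gu k l x * gu j m x * Ric l m x * C k i j x)"
    unfolding cov3_cotton_F cov_vector_F[OF x]
    by (simp add: right_diff_distrib sum_subtractf sum_distrib_left sum_negf mult_ac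
        if_distrib[of "\<lambda>a. _ * a"] cong: if_cong)
  also have "(\<Sum>k\<in>UNIV. \<Sum>l\<in>UNIV. gu k l x * C k i l x) = 0"
    by (subst cotton_antisym[OF x]) (simp add: sum_negf cotton_trace[OF x])
  also have "(\<Sum>k\<in>UNIV. \<Sum>l\<in>UNIV. \<Sum>j\<in>UNIV. \<Sum>m\<in>UNIV. gu k l x * gu j m x * Ric l m x * C k i j x)
      = (\<Sum>k\<in>UNIV. \<Sum>j\<in>UNIV. ricup k j x * C k i j x)"
    by (subst sum_swap_23) (simp add: ricup_def sum_distrib_right)
  finally show ?thesis by simp
qed

lemma cov3_dS_gl:
  "cov3 G (\<lambda>i j l y. pd i S y * gl j l y) k i j l x = cov1 G (\<lambda>i. pd i S) k i x * gl j l x"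
proof -
  have "cov3 G (\<lambda>i j l y. pd i S y * gl j l y) k i j l x
      = cov1 G (\<lambda>i. pd i S) k i x * gl j l x + pd i S x * cov2 G gl k j l x"
    unfolding cov3_def cov1_def cov2_def
    by (simp add: pd_rules[OF x] algebra_simps sum_distrib_left sum_distrib_right)
  then show ?thesis by (simp add: cov2_gl[OF x])
qed

lemma cov3_cotton:
  "cov3 G C k i j l x = \<beta> * (cov1 G (\<lambda>i. pd i S) k i x * gl j l x
      - cov1 G (\<lambda>i. pd i S) k j x * gl i l x)
     + (\<Sum>m\<in>UNIV. cov_rup k m i j l x * du m x) + (\<Sum>m\<in>UNIV. rup m i j l x * cov1 G du k m x)"
proof -
  let ?P = "\<lambda>i j l y. pd i S y * gl j l y" and ?H = "\<lambda>i j l y. \<Sum>m\<in>UNIV. rup m i j l y * du m y"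
  have "pd k (C i j l) x = \<beta> * (pd k (?P i j l) x - pd k (?P j i l) x) + pd k (?H i j l) x"
    by (subst pd_cong'[OF x cotton_eq]) (simp_all add: pd_rules[OF x])
  then have "cov3 G C k i j l x
      = \<beta> * (cov3 G ?P k i j l x - cov3 G ?P k j i l x) + cov3 G ?H k i j l x"
    unfolding cov3_def cotton_eq[OF x]
    by (simp add: distrib_left right_diff_distrib sum.distrib sum_subtractf
        sum_distrib_left[symmetric]
        mult.left_commute[of _ \<beta>])
  then show ?thesis by (simp add: cov3_dS_gl leibniz_rup[OF x])
qed

lemma hess_scalar_sym: "cov1 G (\<lambda>i. pd i S) i j x = cov1 G (\<lambda>i. pd i S) j i x"
  unfolding cov1_def by (simp add: pd_pd[OF x, of S i j] \<Gamma>_sym[OF x, of _ i j])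

text \<open>Each of the three parts of \<open>cov3_cotton\<close> has zero trace: the part with \<open>dR\<close> because the
  Hessian of \<open>R\<close> is symmetric, the derivative of the curvature because its divergence is
  \<open>ricci_curl\<close>, which vanishes on the gradient, and the Hessian of the potential because it is
  symmetric and is contracted with the antisymmetric \<open>rup_up\<close>.\<close>

lemma div_cotton_last: "(\<Sum>k\<in>UNIV. \<Sum>l\<in>UNIV. gu k l x * cov3 G C l i j k x) = 0"
proof -
  let ?H = "cov1 G (\<lambda>i. pd i S)"
  have A: "(\<Sum>k\<in>UNIV. \<Sum>l\<in>UNIV. gu k l x * (?H l i x * gl j k x)) = ?H j i x" for i j
    using gu_gl_contract[OF x, of "\<lambda>l. ?H l i x" j]
    by (subst sum.swap, subst gu_sym[OF x], subst gl_sym[OF x])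
  have B: "(\<Sum>k\<in>UNIV. \<Sum>l\<in>UNIV. gu k l x * (\<Sum>m\<in>UNIV. cov_rup l m i j k x * du m x)) = 0"
  proof -
    have "(\<Sum>k\<in>UNIV. \<Sum>l\<in>UNIV. gu k l x * (\<Sum>m\<in>UNIV. cov_rup l m i j k x * du m x))
      = (\<Sum>m\<in>UNIV. (\<Sum>l\<in>UNIV. \<Sum>k\<in>UNIV. gu k l x * cov_rup l m i j k x) * du m x)"
      by (simp add: sum_distrib_left sum_distrib_right mult.assoc, rule sum_swap_13)
    also have "\<dots> = - (\<Sum>m\<in>UNIV. (\<Sum>b\<in>UNIV. gu b m x * ricci_curl i j b x) * du m x)"
      unfolding trace_cov_rup_last[OF x, of "\<lambda>l. l" _ "\<lambda>_. i" "\<lambda>_. j"] div_rup[OF x] ricci_curl_def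
      by (simp add: sum_negf)
    also have "(\<Sum>m\<in>UNIV. (\<Sum>b\<in>UNIV. gu b m x * ricci_curl i j b x) * du m x)
        = (\<Sum>b\<in>UNIV. ricci_curl i j b x * F b x)"
      unfolding raise_def by (simp add: sum_distrib_left sum_distrib_right mult_ac, rule sum.swap)
    finally show ?thesis by (simp add: ricci_curl_F[OF x])
  qed
  have D: "(\<Sum>k\<in>UNIV. \<Sum>l\<in>UNIV. gu k l x * (\<Sum>m\<in>UNIV. rup m i j k x * cov1 G du l m x)) = 0"
    (is "?L = 0")
  proof -
    have L: "?L = (\<Sum>l\<in>UNIV. \<Sum>m\<in>UNIV. rup_up m l i j x * cov1 G du l m x)"
      unfolding rup_up_def by (simp add: sum_distrib_left sum_distrib_right mult_ac, subst
          sum.swap, subst sum_swap_23, rule refl)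
    also have "\<dots> = (\<Sum>l\<in>UNIV. \<Sum>m\<in>UNIV. rup_up l m i j x * cov1 G du l m x)"
      by (subst sum.swap) (simp add: hess[OF x] gl_sym[OF x] ricci_sym[OF x])
    also have "\<dots> = - ?L"
      unfolding L by (subst rup_up_antisym[OF x]) (simp add: sum_negf)
    finally show ?thesis by simp
  qed
  have "(\<Sum>k\<in>UNIV. \<Sum>l\<in>UNIV. gu k l x * cov3 G C l i j k x)
    = \<beta> * ((\<Sum>k\<in>UNIV. \<Sum>l\<in>UNIV. gu k l x * (?H l i x * gl j k x))
        - (\<Sum>k\<in>UNIV. \<Sum>l\<in>UNIV. gu k l x * (?H l j x * gl i k x)))
     + (\<Sum>k\<in>UNIV. \<Sum>l\<in>UNIV. gu k l x * (\<Sum>m\<in>UNIV. cov_rup l m i j k x * du m x))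
     + (\<Sum>k\<in>UNIV. \<Sum>l\<in>UNIV. gu k l x * (\<Sum>m\<in>UNIV. rup m i j k x * cov1 G du l m x))"
    unfolding cov3_cotton
    by (simp only: distrib_left right_diff_distrib sum.distrib sum_subtractf
        sum_distrib_left mult.left_commute[of _ \<beta>])
  then show ?thesis unfolding A B D by (simp add: hess_scalar_sym[of i j])
qed

text \<open>Symmetry of the Bach tensor of a soliton: by the cyclic identity the antisymmetric part of
  \<open>\<nabla>\<^sup>kC\<^bsub>kij\<^esub>\<close> is a divergence in the last slot.\<close>

lemma div_cotton_sym:
  "(\<Sum>k\<in>UNIV. \<Sum>l\<in>UNIV. gu k l x * cov3 G C l k i j x)
      = (\<Sum>k\<in>UNIV. \<Sum>l\<in>UNIV. gu k l x * cov3 G C l k j i x)"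
proof -
  have "cov3 G C l k i j x = cov3 G C l k j i x - cov3 G C l i j k x" for k l
  proof -
    have P: "pd l (C k i j) x = pd l (C k j i) x - pd l (C i j k) x"
      by (subst pd_cong'[OF x cotton_cyclic]) (simp_all add: pd_rules[OF x])
    have Q: "(\<Sum>m\<in>UNIV. \<Gamma> m l k x * C m i j x)
        = (\<Sum>m\<in>UNIV. \<Gamma> m l k x * C m j i x) - (\<Sum>m\<in>UNIV. \<Gamma> m l k x * C i j m x)"
      "(\<Sum>m\<in>UNIV. \<Gamma> m l i x * C k m j x)
          = (\<Sum>m\<in>UNIV. \<Gamma> m l i x * C k j m x) - (\<Sum>m\<in>UNIV. \<Gamma> m l i x * C m j k x)"
      "(\<Sum>m\<in>UNIV. \<Gamma> m l j x * C k i m x)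
          = (\<Sum>m\<in>UNIV. \<Gamma> m l j x * C k m i x) - (\<Sum>m\<in>UNIV. \<Gamma> m l j x * C i m k x)"
      by (subst cotton_cyclic[OF x], simp add: right_diff_distrib sum_subtractf)+
    show ?thesis unfolding cov3_def P Q by simp
  qed
  then show ?thesis
    by (simp add: right_diff_distrib sum_subtractf div_cotton_last)
qed

end

section \<open>The Bach tensor in the direction of the gradient\<close>

text \<open>The coefficient \<open>s\<close> is read off in a coordinate in which the differential of the potential
  does not vanish.\<close>

lemma dS_parallel:
  assumes x: "x \<in> U" and reg: "gradient G u x \<noteq> 0"
  obtains s where "\<And>i. pd i S x = s * du i x" "xi1 \<rho> G u x = \<alpha> * s"
proof -
  obtain k where k: "du k x \<noteq> 0"
  proof (rule ccontr)
    assume "\<not> thesis"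
    then have "du k x = 0" for k using that by blast
    then have "gradient G u x = 0" by (simp add: gradient_def vec_eq_iff)
    then show False using reg by simp
  qed
  define s where "s = pd k S x / du k x"
  have s: "pd i S x = s * du i x" for i
    using dS_wedge_du[OF x, of i k] k by (simp add: s_def field_simps)
  have "metric_form G x (gradient G S x) (gradient G u x)
      = s * metric_form G x (gradient G u x) (gradient G u x)"
    unfolding metric_form_gradient[OF x] s by (simp add: sum_distrib_left mult.assoc)
  then have "xi1 \<rho> G u x = \<alpha> * s"
    using metric_form_pos[OF x reg] unfolding xi1_def n_def[symmetric] \<alpha>_def
        by (simp add: algebra_simps)
  with s that show thesis by blast
qed

text \<open>The part of \<open>R\<^sup>k\<^sup>iC\<^bsub>kji\<^esub>\<close> and, up to sign, of \<open>R\<^sup>a\<^sup>bW\<^bsub>iajb\<^esub>F\<^sup>i\<close> that involves the full Riemann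
  tensor.\<close>

abbreviation curv_term :: "real^'n \<Rightarrow> 'n \<Rightarrow> real" where
  "curv_term x j \<equiv> (\<Sum>k\<in>UNIV. \<Sum>i\<in>UNIV. ricup k i x * (\<Sum>m\<in>UNIV. rup m k j i x * du m x))"

text \<open>The contraction \<open>F\<^sup>iR\<^sup>a\<^sup>bh\<^bsub>iab\<^esub>\<close>, applied below to the Weyl tensor term by term.\<close>

definition contract3 :: "real^'n \<Rightarrow> ('n \<Rightarrow> 'n \<Rightarrow> 'n \<Rightarrow> real) \<Rightarrow> real" where
  "contract3 x h = (\<Sum>i\<in>UNIV. \<Sum>a\<in>UNIV. \<Sum>b\<in>UNIV. F i x * ricup a b x * h i a b)"

lemma contract3_linear:
  "contract3 x (\<lambda>i a b. h i a b + h' i a b) = contract3 x h + contract3 x h'"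
  "contract3 x (\<lambda>i a b. h i a b - h' i a b) = contract3 x h - contract3 x h'"
  "contract3 x (\<lambda>i a b. c * h i a b) = c * contract3 x h"
  unfolding contract3_def
  by (simp_all add: distrib_left right_diff_distrib sum.distrib sum_subtractf
      sum_distrib_left mult_ac)

lemma contract3_product: "contract3 x (\<lambda>i a b. v i * w a b)
    = (\<Sum>i\<in>UNIV. v i * F i x) * (\<Sum>a\<in>UNIV. \<Sum>b\<in>UNIV. ricup a b x * w a b)"
  unfolding contract3_def by (subst sum_distrib_right) (simp add: sum_distrib_left mult_ac)

context
  fixes x assumes x: "x \<in> U"
begin

lemma gl_F: "(\<Sum>i\<in>UNIV. gl i j x * F i x) = du j x"
  by (subst gl_sym[OF x]) (rule lower_raise'[OF x])

lemma contract3_riemann: "contract3 x (\<lambda>i a b. riemann G i a j b x) = - curv_term x j"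
proof -
  \<comment> \<open>brings the indices into the order of \<open>curv_term\<close>: Ricci, \<open>j\<close>, gradient, Ricci\<close>
  have R: "riemann G i a j b x = - riemann G b j i a x" for i a b
    using riemann_pair[OF x, of i a j b] riemann_antisym_left[OF x, of j b i a] by simp
  have "contract3 x (\<lambda>i a b. riemann G i a j b x)
     = - (\<Sum>i\<in>UNIV. \<Sum>a\<in>UNIV. \<Sum>b\<in>UNIV. ricup b a x * (riemann G b j i a x * F i x))"
    unfolding contract3_def R by (subst ricup_sym[OF x]) (simp add: sum_negf mult_ac)
  also have "\<dots> = - (\<Sum>b\<in>UNIV. \<Sum>a\<in>UNIV. \<Sum>i\<in>UNIV. ricup b a x * (riemann G b j i a x * F i x))"
    by (subst sum_swap_13) (rule refl)
  also have "\<dots> = - curv_term x j"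
    unfolding rup_lower[OF x, of _ _ _ du] by (simp add: sum_distrib_left)
  finally show ?thesis .
qed

end

context
  fixes x s \<xi> assumes x: "x \<in> U" and s: "\<And>i. pd i S x = s * du i x" and \<xi>: "\<xi> = \<alpha> * s"
begin

lemma Ric_F_eigen: "(\<Sum>k\<in>UNIV. Ric i k x * F k x) = \<xi> * du i x"
  by (simp add: Ric_F[OF x] s \<xi>)

lemma ricup_du: "(\<Sum>b\<in>UNIV. du b x * ricup a b x) = \<xi> * F a x"
  unfolding ricup_covector[OF x, of du a] Ric_F_eigen
  unfolding raise_def
  by (simp add: sum_distrib_left mult_ac)

lemma ricup_cotton:
  "(\<Sum>k\<in>UNIV. \<Sum>i\<in>UNIV. ricup k i x * C k j i x) = \<beta> * s * (\<xi> - S x) * du j x + curv_term x j"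
proof -
  have A: "(\<Sum>k\<in>UNIV. \<Sum>i\<in>UNIV. ricup k i x * (du k x * gl j i x)) = \<xi> * du j x"
  proof -
    have "(\<Sum>k\<in>UNIV. \<Sum>i\<in>UNIV. ricup k i x * (du k x * gl j i x))
        = (\<Sum>i\<in>UNIV. gl j i x * (\<Sum>k\<in>UNIV. du k x * ricup i k x))"
      by (subst sum.swap, subst ricup_sym[OF x]) (simp add: sum_distrib_left mult_ac)
    also have "\<dots> = \<xi> * (\<Sum>i\<in>UNIV. gl j i x * F i x)"
      unfolding ricup_du by (simp add: sum_distrib_left mult_ac)
    finally show ?thesis by (simp add: lower_raise'[OF x])
  qed
  have B: "(\<Sum>k\<in>UNIV. \<Sum>i\<in>UNIV. ricup k i x * (du j x * gl k i x)) = S x * du j x"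
    using ricup_trace[OF x] by (simp add: sum_distrib_left[symmetric] mult_ac)
  define H where "H k i = (\<Sum>m\<in>UNIV. rup m k j i x * du m x)" for k i
  have "(\<Sum>k\<in>UNIV. \<Sum>i\<in>UNIV. ricup k i x * C k j i x)
    = \<beta> * s * ((\<Sum>k\<in>UNIV. \<Sum>i\<in>UNIV. ricup k i x * (du k x * gl j i x))
        - (\<Sum>k\<in>UNIV. \<Sum>i\<in>UNIV. ricup k i x * (du j x * gl k i x)))
      + (\<Sum>k\<in>UNIV. \<Sum>i\<in>UNIV. ricup k i x * H k i)"
    unfolding cotton_eq[OF x] s H_def[symmetric]
    by (simp add: distrib_left right_diff_distrib sum.distrib sum_subtractf
        sum_distrib_left mult_ac)
  then show ?thesis unfolding A B H_def by (simp add: algebra_simps)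
qed

text \<open>The eigenvector property enters here: after \<open>v\<close> turns \<open>F\<close> into a multiple of \<open>df\<close>, the Ricci
  tensor multiplies by \<open>\<xi>\<close>.\<close>

lemma contract3_cross:
  assumes v: "\<And>b. (\<Sum>i\<in>UNIV. v i b * F i x) = c * du b x"
  shows "contract3 x (\<lambda>i a b. v i b * w a) = c * \<xi> * (\<Sum>a\<in>UNIV. w a * F a x)"
proof -
  have "contract3 x (\<lambda>i a b. v i b * w a)
      = (\<Sum>a\<in>UNIV. \<Sum>b\<in>UNIV. w a * ricup a b x * (\<Sum>i\<in>UNIV. v i b * F i x))"
    unfolding contract3_def by (subst sum_swap_12, subst sum_swap_23) (simp add:
        sum_distrib_left mult_ac)
  also have "\<dots> = (\<Sum>a\<in>UNIV. c * w a * (\<Sum>b\<in>UNIV. du b x * ricup a b x))"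
    unfolding v by (simp add: sum_distrib_left mult_ac)
  also have "\<dots> = c * \<xi> * (\<Sum>a\<in>UNIV. w a * F a x)"
    unfolding ricup_du by (simp add: sum_distrib_left mult_ac)
  finally show ?thesis .
qed

lemma Ric_F_eigen': "(\<Sum>i\<in>UNIV. Ric i j x * F i x) = \<xi> * du j x"
  by (subst ricci_sym[OF x]) (rule Ric_F_eigen)

lemma contract3_weyl:
  "contract3 x (\<lambda>i a b. weyl G i a j b x) = - curv_term x j
     - 1 / (n - 2) * (ricci_norm_sq G x - 2 * \<xi>\<^sup>2 + S x * \<xi>) * du j x
     + S x / ((n - 1) * (n - 2)) * (S x - \<xi>) * du j x"
proof -
  have tr: "(\<Sum>a\<in>UNIV. \<Sum>b\<in>UNIV. ricup a b x * gl a b x) = S x"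
    using ricup_trace[OF x] by (simp add: mult.commute)
  have 1: "contract3 x (\<lambda>i a b. gl i j x * Ric a b x) = du j x * ricci_norm_sq G x"
    unfolding contract3_product by (simp add: gl_F[OF x] ricup_norm[OF x])
  have 2: "contract3 x (\<lambda>i a b. gl i b x * Ric a j x) = \<xi>\<^sup>2 * du j x"
    using contract3_cross[of "\<lambda>i b. gl i b x" 1 "\<lambda>a. Ric a j x"]
    by (simp add: gl_F[OF x] Ric_F_eigen' power2_eq_square)
  have 3: "contract3 x (\<lambda>i a b. gl a j x * Ric i b x) = \<xi>\<^sup>2 * du j x"
    using contract3_cross[of "\<lambda>i b. Ric i b x" \<xi> "\<lambda>a. gl a j x"]
    by (simp add: gl_F[OF x] Ric_F_eigen' power2_eq_square mult.commute)
  have 4: "contract3 x (\<lambda>i a b. gl a b x * Ric i j x) = S x * \<xi> * du j x"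
    by (subst mult.commute, subst contract3_product) (simp add: Ric_F_eigen' tr)
  have 5: "contract3 x (\<lambda>i a b. gl i j x * gl a b x) = du j x * S x"
    unfolding contract3_product by (simp add: gl_F[OF x] tr)
  have 6: "contract3 x (\<lambda>i a b. gl i b x * gl a j x) = \<xi> * du j x"
    using contract3_cross[of "\<lambda>i b. gl i b x" 1 "\<lambda>a. gl a j x"] by (simp add: gl_F[OF x])
  show ?thesis
    unfolding weyl_def Let_def n_def[symmetric] contract3_linear 1 2 3 4 5 6 contract3_riemann[OF x]
    by (simp add: algebra_simps)
qed

text \<open>Both occurrences of the gradient in the Bach tensor are now algebraic in the Ricci tensor. The
  divergence of the Cotton tensor is first transposed by \<open>div_cotton_sym\<close>, since \<open>div_cotton_F\<close>
  needs the gradient in the last slot.\<close>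

lemma bach_F:
  "(\<Sum>i\<in>UNIV. bach G i j x * F i x)
    = (n * \<xi>\<^sup>2 - 2 * S x * \<xi> - ((n - 1) * ricci_norm_sq G x - (S x)\<^sup>2)) / ((n - 1) * (n
        - 2)\<^sup>2) * du j x"
proof -
  let ?D = "\<lambda>i j. \<Sum>k\<in>UNIV. \<Sum>l\<in>UNIV. gu k l x * cov3 G C l k i j x"
  let ?W = "\<lambda>i. \<Sum>k\<in>UNIV. \<Sum>l\<in>UNIV. \<Sum>a\<in>UNIV. \<Sum>b\<in>UNIV.
             Ric k l x * gu k a x * gu l b x * weyl G i a j b x"
  have expand: "e * (d + w) * f = e * (d * f + f * w)" for e d w f :: real
    by (simp add: algebra_simps)
  have "(\<Sum>i\<in>UNIV. bach G i j x * F i x)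
      = 1 / (n - 2) * ((\<Sum>i\<in>UNIV. ?D i j * F i x) + (\<Sum>i\<in>UNIV. F i x * ?W i))"
    unfolding bach_def Let_def n_def[symmetric]
    by (simp only: expand sum.distrib sum_distrib_left[symmetric])
  also have "(\<Sum>i\<in>UNIV. ?D i j * F i x) = (\<Sum>i\<in>UNIV. ?D j i * F i x)"
    by (subst div_cotton_sym[OF x]) (rule refl)
  also have "\<dots> = \<beta> * s * (\<xi> - S x) * du j x + curv_term x j"
    unfolding div_cotton_F[OF x] by (rule ricup_cotton)
  also have "(\<Sum>i\<in>UNIV. F i x * ?W i) = contract3 x (\<lambda>i a b. weyl G i a j b x)"
    unfolding weyl_contract[OF x, of "\<lambda>i. F i x" "\<lambda>i a b. weyl G i a j b x"] contract3_def ..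
  also have "\<beta> * s = - \<xi> / (n - 1)"
    unfolding \<xi> \<alpha>_def \<beta>_def using n_gt by (simp add: field_simps)
  finally show ?thesis
    unfolding contract3_weyl
    using bach_coefficient[of "n - 2" \<xi> "S x" "du j x" "curv_term x j" "ricci_norm_sq G x"] n_gt
        by (simp add: add.commute)
qed

end

lemma bach_gradient:
  assumes x: "x \<in> U" and reg: "gradient G u x \<noteq> 0"
  shows "bach_form G x (gradient G u x) v
    = mu \<rho> G u x / ((n - 1) * (n - 2)\<^sup>2) * metric_form G x (gradient G u x) v"
proof -
  obtain s where s: "\<And>i. pd i S x = s * du i x" "xi1 \<rho> G u x = \<alpha> * s"
    using dS_parallel[OF assms] by blast
  have mu: "(\<Sum>i\<in>UNIV. bach G i j x * F i x) = mu \<rho> G u x / ((n - 1) * (n - 2)\<^sup>2) * du j x" for j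
    using bach_F[OF x s(1) s(2)] unfolding mu_def Let_def n_def by simp
  have "bach_form G x (gradient G u x) v = (\<Sum>j\<in>UNIV. (\<Sum>i\<in>UNIV. bach G i j x * F i x) * v $ j)"
    unfolding bach_form_def gradient_raise by (subst sum.swap) (simp add: sum_distrib_right)
  then show ?thesis
    unfolding mu metric_form_gradient[OF x] by (simp add: sum_distrib_left mult.assoc)
qed

end

theorem proposition3p4:
  fixes M :: "'m topology"
    and A :: "('m, 'n::finite) chart set"
    and g :: "('m, 'n) chart \<Rightarrow> 'n metric"
    and f :: "'m \<Rightarrow> real"
    and \<rho> lam :: real
    and X :: "('m, 'n) chart \<Rightarrow> real^'n \<Rightarrow> real^'n"
    and c :: "('m, 'n) chart"
    and p :: 'm
  assumes "CARD('n) \<ge> 3"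
    and "gradient_rho_einstein_soliton M A g f \<rho> lam"
    and "\<rho> = 0 \<longrightarrow> dR_wedge_df_zero A g f"
    and "vector_field A X"
    and "c \<in> A" and "p \<in> chart_dom c"
    and "gradient (g c) (in_chart c f) (chart_map c p) \<noteq> 0"
  shows "bach_form (g c) (chart_map c p)
           (gradient (g c) (in_chart c f) (chart_map c p)) (X c (chart_map c p))
         = mu \<rho> (g c) (in_chart c f) (chart_map c p)
             / ((real CARD('n) - 1) * (real CARD('n) - 2)\<^sup>2)
           * metric_form (g c) (chart_map c p)
               (gradient (g c) (in_chart c f) (chart_map c p)) (X c (chart_map c p))"
proof -
  let ?x = "chart_map c p" and ?U = "chart_img c"
  note sol = assms(2)[unfolded gradient_rho_einstein_soliton_def]
  have x: "?x \<in> ?U" using assms(6) by (simp add: chart_img_def)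
  interpret soliton_chart ?U "g c" "in_chart c f" \<rho> lam "real CARD('n)"
  proof
    show "open ?U" using sol assms(5) by (auto simp: smooth_manifold_def is_chart_def)
    show "smooth_fun_on ?U (lower (g c) i j)" for i j
      using sol assms(5) by (auto simp: riemannian_metric_def lower_def[abs_def])
    show "transpose (g c x) = g c x" if "x \<in> ?U" for x
      using sol assms(5) that by (auto simp: riemannian_metric_def)
    show "v \<bullet> (g c x *v v) > 0" if "x \<in> ?U" "v \<noteq> 0" for x v
      using sol assms(5) that by (auto simp: riemannian_metric_def)
    show "smooth_fun_on ?U (in_chart c f)"
      using sol assms(5) by (auto simp: smooth_function_def)
    show "ricci (g c) i j x + hessian (g c) (in_chart c f) i j x
        = (\<rho> * scalar_curv (g c) x + lam) * lower (g c) i j x" if "x \<in> ?U" for i j x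
      using sol assms(5) that by auto
    show "pd i (scalar_curv (g c)) x * pd j (in_chart c f) x
        = pd j (scalar_curv (g c)) x * pd i (in_chart c f) x" if "\<rho> = 0" "x \<in> ?U" for i j x
      using assms(3,5) that by (auto simp: dR_wedge_df_zero_def)
    show "3 \<le> real CARD('n)" using assms(1) by simp
  qed simp
  show ?thesis by (rule bach_gradient[OF x assms(7)])
qed

end
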